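(* Let $M\in\mathbb N_0$, and consider the semidiscrete SBP CPR scheme with polynomial degree $p$, in one of the three bases described in the context (nodal Gauss--Lobatto--Legendre, nodal Gauss--Legendre, or modal Legendre), for the polynomial chaos system $\partial_t u + A(u)\,\partial_x u = 0$, $u=(u_0,\dots,u_M)^T$. Written on each element $e$ and for each component $k=0,\dots,M$ (element index omitted), the scheme is $$ \partial_t \underline{u}_k = -\frac13\sum_{i,j=0}^M \mathrm E[\phi_i\phi_j\phi_k]\Big(\mathbf D\,\underline{u_iu_j}+\mathbf u_j^{*}\,\mathbf D\,\underline{u}_i\Big) - \mathbf M^{-1}\mathbf R^T\mathbf B\Big(\underline f_k^{\mathrm{num}}-\sum_{i,j=0}^M \mathrm E[\phi_i\phi_j\phi_k]\Big(\frac13\mathbf R\,\underline{u_iu_j}+\frac16(\mathbf R\underline{u}_i)\bullet(\mathbf R\underline{u}_j)\Big)\Big). $$ Suppose that the numerical flux $f^{\mathrm{num}}:\mathbb R^{M+1}\times\mathbb R^{M+1}\to\mathbb R^{M+1}$ is entropy stable in the sense of Tadmor, i.e. $$ (u(+)-u(-))\cdot f^{\mathrm{num}}(u(-),u(+))\le \psi(u(+))-\psi(u(-))\qquad\text{for all } u(-),u(+)\in\mathbb R^{M+1}, $$ where $\psi(u)=\frac16\sum_{i,j,k=0}^M \mathrm E[\phi_i\phi_j\phi_k]\,u_iu_ju_k$. Then the scheme is (1) conservative (across elements): for every element $e$ and every $k\in\{0,\dots,M\}$, $\;\frac{d}{dt}\,\underline 1^T\mathbf M\,\underline u_k^{(e)}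 = f^{\mathrm{num},e}_{k,L}-f^{\mathrm{num},e}_{k,R}$, where the numerical flux at an interface is shared by the two adjacent elements, so that $\sum_e \underline 1^T\mathbf M\,\underline u_k^{(e)}$ is constant in time; (2) entropy stable in the discrete norm $\|\cdot\|_{\mathbf M\otimes \hat{\mathrm I}}$ induced by $\mathbf M$: $\;\frac12\frac{d}{dt}\sum_e \|u^{(e)}\|^2_{\mathbf M\otimes\hat{\mathrm I}}\le 0$.
   Context: Polynomial chaos system. $\phi_0\equiv1,\phi_1,\phi_2,\dots$ are the normalised probabilistic Hermite polynomials: polynomials with $\deg\phi_i=i$, orthonormal in $L^2(\mathbb R,\varrho\,dy)$ with $\varrho(y)=\frac1{\sqrt{2\pi}}e^{-y^2/2}$. Set $\mathrm E[\phi_i\phi_j\phi_k]=\int_{\mathbb R}\phi_i\phi_j\phi_k\,\varrho\,dy$, which is symmetric in $i,j,k$. Burgers' equation with a polynomial chaos expansion truncated at order $M$ gives the system $\partial_t u+A(u)\partial_x u=0$ with $[A(u)]_{jk}=\sum_{i=0}^M \mathrm E[\phi_i\phi_j\phi_k]u_i$, equivalently $\partial_t u+\partial_x f(u)=0$ with $f(u)=\frac12A(u)u$. The entropy is $U=\frac12|u|^2$ and $\psi$ is the flux potential. Mesh and boundary conditions. The domain $D\subset\mathbb R$ is split into disjoint open intervals (elements) $D_e$ of length $\Delta x_e$, numbered from left to right. Either the setting is periodic (finitely many elements $e=1,\dots,N$, with element $1$ being the right neighbour of element $N$), or it is compactly supported ($e\in\mathbb Z$, and there is a finite set of elements, independent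 of time in the time interval considered, outside of which the numerical solution is zero). The numerical solution is a time-differentiable family of coefficient vectors $\underline u_k^{(e)}(t)\in\mathbb R^{p+1}$ satisfying the scheme. Operators on an element. Each element is mapped affinely to the reference element $(-1,1)$. Polynomials of degree $\le p$ on $[-1,1]$ are represented by coefficient vectors $\underline v\in\mathbb R^{p+1}$ with respect to one of the following bases: (i) nodal Gauss--Lobatto--Legendre ($p\ge1$) or (ii) nodal Gauss--Legendre: the Lagrange basis at the $p+1$ corresponding quadrature nodes $\zeta_0,\dots,\zeta_p$; the mass matrix $\mathbf M$ is the diagonal matrix of quadrature weights; $\mathbf v$ (the multiplication matrix of $v$) is the diagonal matrix $\mathrm{diag}(v(\zeta_0),\dots,v(\zeta_p))$; (iii) modal Legendre: the basis of Legendre polynomials of degree $0,\dots,p$; $\mathbf M$ is the exact $L^2(-1,1)$ Gram matrix; $\mathbf v$ is the matrix of the map $w\mapsto$ ($L^2(-1,1)$-orthogonal projection of the exact product $vw$ onto polynomials of degree $\le p$). In all cases: $\mathbf D$ is the matrix of exact differentiation of polynomials of degree $\le p$; $\mathbf R\in\mathbb R^{2\times(p+1)}$ evaluates the polynomial at the boundary, $\mathbf R\underline v=(v(-1),v(1))^T=(v_L,v_R)^T$; $\mathbf B=\mathrm{diag}(-1,1)$; $\underline 1$ is the coefficient vector of the constant function $1$. On an element of length $\Delta x_e$ the matrices $\mathbf D$ and $\mathbf M$ are these reference matrices multiplied by $2/\Delta x_e$ and $\Delta x_e/2$, respectively, while $\mathbf R,\mathbf B$ are unchanged. These operators satisfy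 the summation-by-parts property $\mathbf M\mathbf D+\mathbf D^T\mathbf M=\mathbf R^T\mathbf B\mathbf R$. Further notation: $\underline{u_iu_j}:=\mathbf u_i\,\underline u_j=\mathbf u_j\,\underline u_i$ is the discrete product; $\mathbf u_j^{*}:=\mathbf M^{-1}\mathbf u_j^T\mathbf M$ is the $\mathbf M$-adjoint of the multiplication matrix $\mathbf u_j$; $\bullet$ is the componentwise (Hadamard) product of vectors in $\mathbb R^2$. Numerical fluxes. On element $e$, $\underline f_k^{\mathrm{num}}=(f^{\mathrm{num},e}_{k,L},f^{\mathrm{num},e}_{k,R})^T$ collects the $k$-th components of the numerical fluxes at the left and right boundary. At the interface between elements $e-1$ and $e$ there is a single numerical flux $f_R^{\mathrm{num},e-1}=f_L^{\mathrm{num},e}=f^{\mathrm{num}}(u(-),u(+))$, with $u(-)=u_R^{(e-1)}\in\mathbb R^{M+1}$ the vector of boundary values $(u_{k,R}^{(e-1)})_k$ of element $e-1$ at its right end and $u(+)=u_L^{(e)}$ the vector of boundary values of element $e$ at its left end. Norm. $\|u^{(e)}\|^2_{\mathbf M\otimes\hat{\mathrm I}}=\sum_{k=0}^M(\underline u_k^{(e)})^T\mathbf M\,\underline u_k^{(e)}$, where $\hat{\mathrm I}$ is the $(M+1)\times(M+1)$ identity. *)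

theory Defs
  imports
    "HOL-Probability.Probability"
    "HOL-Computational_Algebra.Polynomial"
    "Jordan_Normal_Form.Gauss_Jordan_Elimination"
begin

(* Vectors and matrices are those of Jordan_Normal_Form; the clashing notation of
   HOL-Analysis is switched off. *)
unbundle no vec_syntax
unbundle no inner_syntax

section \<open>Polynomial chaos\<close>

primrec hermite :: "nat \<Rightarrow> real poly" where
  "hermite 0 = 1"
| "hermite (Suc n) = [:0, 1:] * hermite n - pderiv (hermite n)"

(* The squared norm of the n-th probabilistic Hermite polynomial in
   L^2(R, std_normal_density) is n!. *)
definition chaos_poly :: "nat \<Rightarrow> real poly" where
  "chaos_poly n = Polynomial.smult (1 / sqrt (fact n)) (hermite n)"

definition triple_E :: "nat \<Rightarrow> nat \<Rightarrow> nat \<Rightarrow> real" where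
  "triple_E i j k =
     (LINT y|lborel. poly (chaos_poly i) y * poly (chaos_poly j) y * poly (chaos_poly k) y
        * std_normal_density y)"

definition flux_potential :: "nat \<Rightarrow> real vec \<Rightarrow> real" where
  "flux_potential M u =
     (1/6) * (\<Sum>i\<le>M. \<Sum>j\<le>M. \<Sum>k\<le>M. triple_E i j k * u $ i * u $ j * u $ k)"

definition entropy_stable_flux ::
    "nat \<Rightarrow> (real vec \<Rightarrow> real vec \<Rightarrow> real vec) \<Rightarrow> bool" where
  "entropy_stable_flux M fnum \<longleftrightarrow>
     (\<forall>um\<in>carrier_vec (M + 1). \<forall>up\<in>carrier_vec (M + 1).
        (up - um) \<bullet> fnum um up \<le> flux_potential M up - flux_potential M um)"

section \<open>Operators on the reference element\<close>

(* Rodrigues formula *)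
definition legendre :: "nat \<Rightarrow> real poly" where
  "legendre n = Polynomial.smult (1 / (2 ^ n * fact n)) ((pderiv ^^ n) ([:-1, 0, 1:] ^ n))"

datatype basis_kind = Gauss_Lobatto | Gauss_Legendre | Modal_Legendre

definition lobatto_nodes :: "nat \<Rightarrow> real list" where
  "lobatto_nodes p = sorted_list_of_set ({-1, 1} \<union> {x. poly (pderiv (legendre p)) x = 0})"

definition gauss_nodes :: "nat \<Rightarrow> real list" where
  "gauss_nodes p = sorted_list_of_set {x. poly (legendre (p + 1)) x = 0}"

definition lagrange_poly :: "real list \<Rightarrow> nat \<Rightarrow> real poly" where
  "lagrange_poly zs i =
     (\<Prod>j\<in>{..<length zs} - {i}. Polynomial.smult (1 / (zs ! i - zs ! j)) [:- (zs ! j), 1:])"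

definition quad_weight :: "real list \<Rightarrow> nat \<Rightarrow> real" where
  "quad_weight zs i = integral {-1..1} (poly (lagrange_poly zs i))"

fun basis_poly :: "basis_kind \<Rightarrow> nat \<Rightarrow> nat \<Rightarrow> real poly" where
  "basis_poly Gauss_Lobatto p i = lagrange_poly (lobatto_nodes p) i"
| "basis_poly Gauss_Legendre p i = lagrange_poly (gauss_nodes p) i"
| "basis_poly Modal_Legendre p i = legendre i"

definition poly_of_coeffs :: "basis_kind \<Rightarrow> nat \<Rightarrow> real vec \<Rightarrow> real poly" where
  "poly_of_coeffs b p v = (\<Sum>i\<le>p. Polynomial.smult (v $ i) (basis_poly b p i))"

definition coeff_vec :: "basis_kind \<Rightarrow> nat \<Rightarrow> real poly \<Rightarrow> real vec" where
  "coeff_vec b p q = (THE v. v \<in> carrier_vec (p + 1) \<and> poly_of_coeffs b p v = q)"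

definition matrix_of :: "basis_kind \<Rightarrow> nat \<Rightarrow> (real poly \<Rightarrow> real poly) \<Rightarrow> real mat" where
  "matrix_of b p F =
     mat (p + 1) (p + 1) (\<lambda>(i, j). coeff_vec b p (F (basis_poly b p j)) $ i)"

definition l2_proj :: "nat \<Rightarrow> real poly \<Rightarrow> real poly" where
  "l2_proj p q = (THE r. degree r \<le> p \<and>
     (\<forall>s. degree s \<le> p \<longrightarrow> integral {-1..1} (\<lambda>x. (poly q x - poly r x) * poly s x) = 0))"

definition nodal_mass :: "real list \<Rightarrow> nat \<Rightarrow> real mat" where
  "nodal_mass zs p = mat (p + 1) (p + 1) (\<lambda>(i, j). if i = j then quad_weight zs i else 0)"

fun ref_mass :: "basis_kind \<Rightarrow> nat \<Rightarrow> real mat" where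
  "ref_mass Gauss_Lobatto p = nodal_mass (lobatto_nodes p) p"
| "ref_mass Gauss_Legendre p = nodal_mass (gauss_nodes p) p"
| "ref_mass Modal_Legendre p = mat (p + 1) (p + 1)
     (\<lambda>(i, j). integral {-1..1} (\<lambda>x. poly (legendre i) x * poly (legendre j) x))"

definition ref_deriv :: "basis_kind \<Rightarrow> nat \<Rightarrow> real mat" where
  "ref_deriv b p = matrix_of b p pderiv"

definition nodal_mult :: "real list \<Rightarrow> nat \<Rightarrow> real poly \<Rightarrow> real mat" where
  "nodal_mult zs p q = mat (p + 1) (p + 1) (\<lambda>(i, j). if i = j then poly q (zs ! i) else 0)"

fun mult_mat :: "basis_kind \<Rightarrow> nat \<Rightarrow> real vec \<Rightarrow> real mat" where
  "mult_mat Gauss_Lobatto p v =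
     nodal_mult (lobatto_nodes p) p (poly_of_coeffs Gauss_Lobatto p v)"
| "mult_mat Gauss_Legendre p v =
     nodal_mult (gauss_nodes p) p (poly_of_coeffs Gauss_Legendre p v)"
| "mult_mat Modal_Legendre p v =
     matrix_of Modal_Legendre p (\<lambda>w. l2_proj p (poly_of_coeffs Modal_Legendre p v * w))"

definition disc_prod :: "basis_kind \<Rightarrow> nat \<Rightarrow> real vec \<Rightarrow> real vec \<Rightarrow> real vec" where
  "disc_prod b p v w = mult_mat b p v *\<^sub>v w"

(* Row r = 0 evaluates at the left end -1, row r = 1 at the right end 1. *)
definition restr_mat :: "basis_kind \<Rightarrow> nat \<Rightarrow> real mat" where
  "restr_mat b p =
     mat 2 (p + 1) (\<lambda>(r, j). poly (basis_poly b p j) (if r = 0 then -1 else 1))"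

definition bdry_mat :: "real mat" where
  "bdry_mat = mat 2 2 (\<lambda>(i, j). if i \<noteq> j then 0 else if i = 0 then -1 else 1)"

definition one_coeffs :: "basis_kind \<Rightarrow> nat \<Rightarrow> real vec" where
  "one_coeffs b p = coeff_vec b p 1"

section \<open>Mesh\<close>

datatype setting = Periodic nat | Compact_Support

fun elements :: "setting \<Rightarrow> int set" where
  "elements (Periodic N) = {1..int N}"
| "elements Compact_Support = UNIV"

fun left_nb :: "setting \<Rightarrow> int \<Rightarrow> int" where
  "left_nb (Periodic N) e = (if e = 1 then int N else e - 1)"
| "left_nb Compact_Support e = e - 1"

fun right_nb :: "setting \<Rightarrow> int \<Rightarrow> int" where
  "right_nb (Periodic N) e = (if e = int N then 1 else e + 1)"
| "right_nb Compact_Support e = e + 1"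

(* Element e is the open interval from x (e - 1) to x e. *)
definition valid_mesh :: "setting \<Rightarrow> (int \<Rightarrow> real) \<Rightarrow> bool" where
  "valid_mesh st x \<longleftrightarrow> (\<forall>N. st = Periodic N \<longrightarrow> N \<ge> 1) \<and> (\<forall>e\<in>elements st. x (e - 1) < x e)"

definition elem_len :: "(int \<Rightarrow> real) \<Rightarrow> int \<Rightarrow> real" where
  "elem_len x e = x e - x (e - 1)"

definition elem_deriv :: "basis_kind \<Rightarrow> nat \<Rightarrow> (int \<Rightarrow> real) \<Rightarrow> int \<Rightarrow> real mat" where
  "elem_deriv b p x e = (2 / elem_len x e) \<cdot>\<^sub>m ref_deriv b p"

definition elem_mass :: "basis_kind \<Rightarrow> nat \<Rightarrow> (int \<Rightarrow> real) \<Rightarrow> int \<Rightarrow> real mat" where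
  "elem_mass b p x e = (elem_len x e / 2) \<cdot>\<^sub>m ref_mass b p"

definition elem_mass_inv :: "basis_kind \<Rightarrow> nat \<Rightarrow> (int \<Rightarrow> real) \<Rightarrow> int \<Rightarrow> real mat" where
  "elem_mass_inv b p x e = the (mat_inverse (elem_mass b p x e))"

definition mult_adj ::
    "basis_kind \<Rightarrow> nat \<Rightarrow> (int \<Rightarrow> real) \<Rightarrow> int \<Rightarrow> real vec \<Rightarrow> real mat" where
  "mult_adj b p x e v =
     elem_mass_inv b p x e * transpose_mat (mult_mat b p v) * elem_mass b p x e"

section \<open>The scheme\<close>

(* A discrete state U maps an element e and a component k to the coefficient vector of u_k
   on e. *)

definition left_state :: "basis_kind \<Rightarrow> nat \<Rightarrow> nat \<Rightarrow> (int \<Rightarrow> nat \<Rightarrow> real vec) \<Rightarrow> int \<Rightarrow> real vec" where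
  "left_state b p M U e = vec (M + 1) (\<lambda>k. (restr_mat b p *\<^sub>v U e k) $ 0)"

definition right_state :: "basis_kind \<Rightarrow> nat \<Rightarrow> nat \<Rightarrow> (int \<Rightarrow> nat \<Rightarrow> real vec) \<Rightarrow> int \<Rightarrow> real vec" where
  "right_state b p M U e = vec (M + 1) (\<lambda>k. (restr_mat b p *\<^sub>v U e k) $ 1)"

(* The numerical flux at the interface between e and its left neighbour. *)
definition interface_flux ::
    "setting \<Rightarrow> basis_kind \<Rightarrow> nat \<Rightarrow> nat \<Rightarrow> (real vec \<Rightarrow> real vec \<Rightarrow> real vec) \<Rightarrow>
     (int \<Rightarrow> nat \<Rightarrow> real vec) \<Rightarrow> int \<Rightarrow> real vec" where
  "interface_flux st b p M fnum U e =
     fnum (right_state b p M U (left_nb st e)) (left_state b p M U e)"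

definition flux_left ::
    "setting \<Rightarrow> basis_kind \<Rightarrow> nat \<Rightarrow> nat \<Rightarrow> (real vec \<Rightarrow> real vec \<Rightarrow> real vec) \<Rightarrow>
     (int \<Rightarrow> nat \<Rightarrow> real vec) \<Rightarrow> int \<Rightarrow> nat \<Rightarrow> real" where
  "flux_left st b p M fnum U e k = interface_flux st b p M fnum U e $ k"

definition flux_right ::
    "setting \<Rightarrow> basis_kind \<Rightarrow> nat \<Rightarrow> nat \<Rightarrow> (real vec \<Rightarrow> real vec \<Rightarrow> real vec) \<Rightarrow>
     (int \<Rightarrow> nat \<Rightarrow> real vec) \<Rightarrow> int \<Rightarrow> nat \<Rightarrow> real" where
  "flux_right st b p M fnum U e k = interface_flux st b p M fnum U (right_nb st e) $ k"

definition hadamard :: "real vec \<Rightarrow> real vec \<Rightarrow> real vec" where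
  "hadamard v w = vec (dim_vec v) (\<lambda>i. v $ i * w $ i)"

(* The vector sum over i, j of E[phi_i phi_j phi_k] w i j in R^n. *)
definition chaos_sum :: "nat \<Rightarrow> nat \<Rightarrow> nat \<Rightarrow> (nat \<Rightarrow> nat \<Rightarrow> real vec) \<Rightarrow> real vec" where
  "chaos_sum M n k w = vec n (\<lambda>l. \<Sum>i\<le>M. \<Sum>j\<le>M. triple_E i j k * w i j $ l)"

definition scheme_rhs ::
    "setting \<Rightarrow> basis_kind \<Rightarrow> nat \<Rightarrow> nat \<Rightarrow> (int \<Rightarrow> real) \<Rightarrow>
     (real vec \<Rightarrow> real vec \<Rightarrow> real vec) \<Rightarrow> (int \<Rightarrow> nat \<Rightarrow> real vec) \<Rightarrow> int \<Rightarrow> nat \<Rightarrow> real vec" where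
  "scheme_rhs st b p M x fnum U e k =
     (let D = elem_deriv b p x e; R = restr_mat b p;
          fk = vec 2 (\<lambda>r. if r = 0 then flux_left st b p M fnum U e k
                            else flux_right st b p M fnum U e k)
      in (- (1/3)) \<cdot>\<^sub>v chaos_sum M (p + 1) k (\<lambda>i j.
             D *\<^sub>v disc_prod b p (U e i) (U e j) + mult_adj b p x e (U e j) *\<^sub>v (D *\<^sub>v U e i))
         - elem_mass_inv b p x e *\<^sub>v (transpose_mat R *\<^sub>v (bdry_mat *\<^sub>v
             (fk - chaos_sum M 2 k (\<lambda>i j.
                (1/3) \<cdot>\<^sub>v (R *\<^sub>v disc_prod b p (U e i) (U e j))
                + (1/6) \<cdot>\<^sub>v hadamard (R *\<^sub>v U e i) (R *\<^sub>v U e j))))))"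

definition elem_norm_sq ::
    "basis_kind \<Rightarrow> nat \<Rightarrow> nat \<Rightarrow> (int \<Rightarrow> real) \<Rightarrow> (int \<Rightarrow> nat \<Rightarrow> real vec) \<Rightarrow> int \<Rightarrow> real" where
  "elem_norm_sq b p M x U e = (\<Sum>k\<le>M. U e k \<bullet> (elem_mass b p x e *\<^sub>v U e k))"

end

theory Submission
  imports Defs
begin

text \<open>
The argument is the energy method for a split form of Burgers' equation, carried out with discrete
operators that imitate integration by parts.

Let $M$ denote the mass matrix of an element. The scheme discretises the flux derivative by one third
of $D(u_i u_j) + u_j^* D u_i$, summed with the weights $\mathrm{E}[\phi_i \phi_j \phi_k]$. Tested with
$\varphi$, the $M$-adjoint in the second term moves the multiplication to the test function, so that the
volume terms are
$\varphi^T M D (u_i u_j) + (u_j \varphi)^T M D u_i$ (lemma \<open>rhs_tested\<close>).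
For $\varphi = 1$ the symmetry of the weights in $i, j$ makes both terms exact
derivatives. For $\varphi = u_k$ and after summation over $k$, the symmetry in $i, k$ turns the second
term into $(u_i u_j)^T M D u_k$, and the two are a product rule. In both cases summation by parts leaves
only boundary values; the correction terms in the interface part are chosen to cancel them, up to
the flux potential $\psi$ of the boundary states. This gives
the balance $f_L - f_R$ for the mass of each component (\<open>element_conservation\<close>)
and, for the entropy, the difference of $u \cdot f^{num} - \psi(u)$ between the left and the right end
(\<open>element_entropy_rate\<close>). Regrouping the sum over all elements by interfaces
(\<open>infsum_telescope_neighbours\<close>), the mass balance telescopes to 0, and every interface contributes
$(u(+) - u(-)) \cdot f^{num} - (\psi(u(+)) - \psi(u(-)))$ to the entropy rate, which is nonpositive by Tadmor's
condition (\<open>interface_entropy_production_nonpos\<close>).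

The properties of the operators that enter on an element are collected in the locale
\<open>sbp_operators\<close>: a symmetric invertible mass matrix, summation by parts, exactness for
constants, and a commutative discrete product with unit 1. That the three concrete bases have them is
shown in a uniform way (\<open>element_sbp_operators\<close>). In each of them the coefficients are dual functionals
that extend to all polynomials (\<open>coord\<close>), the mass matrix is diagonal with positive weights, and
the discrete product of two coefficient vectors consists of the dual functionals of the exact product of the
polynomials. Summation by parts follows from exact integration by parts because
the discrete inner product is exact when one factor is a derivative
(\<open>weighted_coords_eq_pint\<close>). For the nodal bases this is the exactness of Gauss quadrature up to degree
$2p + 1$ and of Lobatto quadrature up to degree $2p - 1$, which rests on the orthogonality of Legendre
polynomials. That there are enough distinct nodes follows by applying Rolle's theorem repeatedly to
$(x^2 - 1)^n$ in Rodrigues' formula.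
\<close>

section \<open>Integrals of polynomials over the reference interval\<close>

definition pint :: "real poly \<Rightarrow> real" where
  "pint f = integral {-1..1} (poly f)"

lemma poly_integrable: "poly (f :: real poly) integrable_on {-1..1}"
  by (rule integrable_continuous_interval) (intro continuous_intros)

lemma pint_add: "pint (f + g) = pint f + pint g"
  unfolding pint_def using integral_add[OF poly_integrable[of f] poly_integrable[of g]]
  by (simp add: poly_add[abs_def])

lemma pint_smult: "pint (Polynomial.smult c f) = c * pint f"
  unfolding pint_def by (simp add: poly_smult[abs_def])

lemma pint_0 [simp]: "pint 0 = 0"
  using pint_smult[of 0 0] by simp

lemma pint_uminus: "pint (- f) = - pint f"
  using pint_smult[of "-1" f] by simp

lemma pint_diff: "pint (f - g) = pint f - pint g"
  using pint_add[of f "-g"] by (simp add: pint_uminus)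

lemma pint_sum: "pint (\<Sum>i\<in>A. f i) = (\<Sum>i\<in>A. pint (f i))"
  by (induction A rule: infinite_finite_induct) (auto simp: pint_add)

lemma pint_pderiv: "pint (pderiv f) = poly f 1 - poly f (-1)"
proof -
  have "(poly (pderiv f) has_integral (poly f 1 - poly f (-1))) {-1..1}"
    by (rule fundamental_theorem_of_calculus)
       (auto simp flip: has_real_derivative_iff_has_vector_derivative
             intro: DERIV_subset[OF poly_DERIV])
  thus ?thesis unfolding pint_def by (rule integral_unique)
qed

lemma pint_by_parts:
  "pint (f * pderiv g) = poly f 1 * poly g 1 - poly f (-1) * poly g (-1) - pint (pderiv f * g)"
  using pint_pderiv[of "f * g"] by (simp add: pderiv_mult pint_add mult.commute)

text \<open>A nonzero polynomial has finitely many zeros, so a nonnegative one cannot have integral 0.\<close>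

lemma pint_pos:
  assumes "f \<noteq> 0" and "\<And>x. x \<in> {-1..1} \<Longrightarrow> 0 \<le> poly f x"
  shows "0 < pint f"
proof -
  have "0 \<le> pint f"
    unfolding pint_def by (rule Henstock_Kurzweil_Integration.integral_nonneg) (auto intro: poly_integrable assms)
  moreover have "pint f \<noteq> 0"
  proof
    assume "pint f = 0"
    hence "\<forall>x\<in>{-1..1}. poly f x = 0"
      unfolding pint_def using assms(2)
      by (subst (asm) integral_eq_0_iff) (auto intro!: continuous_intros)
    hence "{-1..1} \<subseteq> {x. poly f x = 0}" by auto
    moreover have "finite {x. poly f x = 0}" using assms(1) by (rule poly_roots_finite)
    ultimately have "finite {-1..1::real}" by (rule finite_subset)
    thus False using infinite_Icc[of "-1" "1::real"] by simp
  qed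
  ultimately show ?thesis by simp
qed

lemma pint_square_pos: "f \<noteq> 0 \<Longrightarrow> 0 < pint (f * f)"
  by (rule pint_pos) auto

section \<open>Zeros and orthogonality of Legendre polynomials\<close>

text \<open>Each gap between two neighbouring zeros contributes one zero of the derivative by the mean value
theorem; adding the zeros from left to right keeps the new ones distinct.\<close>

lemma rolle_roots:
  fixes f :: "real poly"
  assumes "finite S" "S \<noteq> {}" "\<And>s. s \<in> S \<Longrightarrow> poly f s = 0"
  shows "\<exists>T. finite T \<and> card S = Suc (card T) \<and> T \<subseteq> {Min S<..<Max S} \<and>
             (\<forall>t\<in>T. poly (pderiv f) t = 0)"
  using assms
proof (induction S rule: finite_linorder_max_induct)
  case empty
  thus ?case by simp
next
  case (insert b A)
  show ?case
  proof (cases "A = {}")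
    case True
    thus ?thesis by (intro exI[of _ "{}"]) simp
  next
    case False
    then obtain T where T: "finite T" "card A = Suc (card T)" "T \<subseteq> {Min A<..<Max A}"
        "\<forall>t\<in>T. poly (pderiv f) t = 0"
      using insert.IH insert.prems by auto
    have lt: "Max A < b" using insert.hyps False by simp
    have le: "Min A \<le> Max A" using insert.hyps False by simp
    obtain y where y: "Max A < y" "y < b" "poly f b - poly f (Max A) = (b - Max A) * poly (pderiv f) y"
      using poly_MVT[OF lt, of f] by auto
    have "poly f b = 0" "poly f (Max A) = 0"
      using insert.prems insert.hyps False by auto
    hence y0: "poly (pderiv f) y = 0" using y lt by auto
    have MM: "Max (insert b A) = b" "Min (insert b A) = Min A"
      using insert.hyps False lt le by auto
    have "y \<notin> T" using T(3) y by auto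
    moreover have "b \<notin> A" using insert.hyps by auto
    ultimately show ?thesis
      using T y y0 le MM insert.hyps by (intro exI[of _ "insert y T"]) auto
  qed
qed

lemma roots_eq_if_card:
  fixes f :: "real poly"
  assumes "f \<noteq> 0" "\<And>t. t \<in> T \<Longrightarrow> poly f t = 0" "card T = degree f"
  shows "{x. poly f x = 0} = T"
proof -
  have "T \<subseteq> {x. poly f x = 0}" using assms(2) by auto
  moreover have "card {x. poly f x = 0} \<le> card T"
    using card_poly_roots_bound[OF assms(1)] assms(3) by simp
  ultimately show ?thesis
    using poly_roots_finite[OF assms(1)] by (metis card_seteq)
qed

abbreviation rodrigues :: "nat \<Rightarrow> real poly" where
  "rodrigues n \<equiv> [:-1, 0, 1:] ^ n"

lemma power_dvd_pderiv:
  fixes q f :: "real poly"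
  assumes "q ^ Suc m dvd f"
  shows "q ^ m dvd pderiv f"
proof -
  obtain g where f: "f = q ^ Suc m * g" using assms by (rule dvdE)
  have "pderiv f = q ^ m * (q * pderiv g + g * Polynomial.smult (of_nat (Suc m)) (pderiv q))"
    unfolding f pderiv_mult pderiv_power_Suc by (simp add: algebra_simps)
  thus ?thesis by (rule dvdI)
qed

text \<open>Every derivative costs one power of the factor $x^2 - 1$, so that fewer than $n$ derivatives of
$(x^2-1)^n$ still vanish at both end points. This removes all boundary terms when Rodrigues' formula
is integrated by parts, and it supplies the two extra zeros at each step of the Rolle argument.\<close>

lemma power_dvd_rodrigues_pderiv:
  "k \<le> n \<Longrightarrow> [:-1, 0, 1:] ^ (n - k) dvd (pderiv ^^ k) (rodrigues n)"
proof (induction k)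
  case (Suc k)
  hence "[:-1, 0, 1:] ^ Suc (n - Suc k) dvd (pderiv ^^ k) (rodrigues n)"
    by (simp add: Suc_diff_Suc del: power_Suc)
  thus ?case using power_dvd_pderiv by simp
qed simp

lemma rodrigues_pderiv_boundary:
  assumes "k < n"
  shows "poly ((pderiv ^^ k) (rodrigues n)) 1 = 0" "poly ((pderiv ^^ k) (rodrigues n)) (-1) = 0"
proof -
  obtain g where "(pderiv ^^ k) (rodrigues n) = [:-1, 0, 1:] ^ (n - k) * g"
    using power_dvd_rodrigues_pderiv[of k n] assms by (auto elim: dvdE)
  thus "poly ((pderiv ^^ k) (rodrigues n)) 1 = 0" "poly ((pderiv ^^ k) (rodrigues n)) (-1) = 0"
    using assms by simp_all
qed

lemma degree_legendre [simp]: "degree (legendre n) = n"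
  unfolding legendre_def by (simp add: degree_higher_pderiv degree_power_eq)

lemma legendre_0: "legendre 0 = 1"
  by (simp add: legendre_def)

lemma legendre_nz [simp]: "legendre n \<noteq> 0"
  by (metis degree_0 degree_legendre legendre_0 one_neq_zero)

text \<open>Together with the zeros at $\pm 1$ the $k$ interior zeros bound $k + 1$ gaps, and Rolle's theorem
produces one zero of the next derivative in each of them.\<close>

lemma rodrigues_pderiv_roots:
  "k \<le> n \<Longrightarrow> \<exists>T. finite T \<and> card T = k \<and> T \<subseteq> {-1<..<1} \<and>
     (\<forall>t\<in>T. poly ((pderiv ^^ k) (rodrigues n)) t = 0)"
proof (induction k)
  case (Suc k)
  then obtain T where T: "finite T" "card T = k" "T \<subseteq> {-1<..<1}"
      "\<forall>t\<in>T. poly ((pderiv ^^ k) (rodrigues n)) t = 0"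
    by auto
  let ?S = "insert (-1) (insert 1 T)"
  have "\<exists>T'. finite T' \<and> card ?S = Suc (card T') \<and> T' \<subseteq> {Min ?S<..<Max ?S} \<and>
             (\<forall>t\<in>T'. poly (pderiv ((pderiv ^^ k) (rodrigues n))) t = 0)"
    using T Suc.prems rodrigues_pderiv_boundary[of k n] by (intro rolle_roots) auto
  moreover have "card ?S = Suc (Suc k)"
    using T by (subst card_insert_disjoint; (subst card_insert_disjoint)?) auto
  moreover have "Min ?S = -1" "Max ?S = 1"
    using T by (fastforce intro!: Min_eqI Max_eqI)+
  ultimately show ?case by auto
qed (auto intro!: exI[of _ "{}"])

text \<open>The $n$ zeros found by Rolle's theorem exhaust the degree. Hence the Gauss nodes are exactly $n$
distinct interior points.\<close>

lemma legendre_roots: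
  "card {x. poly (legendre n) x = 0} = n" "{x. poly (legendre n) x = 0} \<subseteq> {-1<..<1}"
proof -
  obtain T where T: "card T = n" "T \<subseteq> {-1<..<1}"
      "\<forall>t\<in>T. poly ((pderiv ^^ n) (rodrigues n)) t = 0"
    using rodrigues_pderiv_roots[of n n] by auto
  hence "\<forall>t\<in>T. poly (legendre n) t = 0" by (simp add: legendre_def)
  hence "{x. poly (legendre n) x = 0} = T"
    using T(1) by (intro roots_eq_if_card) auto
  thus "card {x. poly (legendre n) x = 0} = n" "{x. poly (legendre n) x = 0} \<subseteq> {-1<..<1}"
    using T by auto
qed

text \<open>One more Rolle step, now between the $n$ zeros of the Legendre polynomial itself, yields $n - 1$
zeros, again as many as the degree allows. These are the interior Lobatto nodes.\<close>

lemma pderiv_legendre_roots: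
  assumes "n \<ge> 1"
  shows "card {x. poly (pderiv (legendre n)) x = 0} = n - 1"
    "{x. poly (pderiv (legendre n)) x = 0} \<subseteq> {-1<..<1}"
proof -
  define S where "S = {x. poly (legendre n) x = 0}"
  have S: "card S = n" "S \<subseteq> {-1<..<1}" using legendre_roots[of n] by (simp_all add: S_def)
  have S': "finite S" "S \<noteq> {}"
    using S(1) assms by (auto intro: card_ge_0_finite)
  obtain T where T: "card S = Suc (card T)" "T \<subseteq> {Min S<..<Max S}"
      "\<forall>t\<in>T. poly (pderiv (legendre n)) t = 0"
    using rolle_roots[OF S', of "legendre n"] by (auto simp: S_def)
  have "Min S \<in> {-1<..<1}" "Max S \<in> {-1<..<1}"
    using Min_in[OF S'] Max_in[OF S'] S(2) by blast+
  hence "T \<subseteq> {-1<..<1}" using T(2) by (auto simp: subset_iff)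
  moreover have "pderiv (legendre n) \<noteq> 0" using assms by (simp add: pderiv_eq_0_iff)
  hence "{x. poly (pderiv (legendre n)) x = 0} = T"
    using T(1,3) S(1) by (intro roots_eq_if_card) (auto simp: degree_pderiv)
  ultimately show "card {x. poly (pderiv (legendre n)) x = 0} = n - 1"
    "{x. poly (pderiv (legendre n)) x = 0} \<subseteq> {-1<..<1}"
    using T(1) S(1) by auto
qed

lemma rodrigues_by_parts:
  "k \<le> n \<Longrightarrow> pint (q * (pderiv ^^ k) (rodrigues n)) = (-1) ^ k * pint ((pderiv ^^ k) q * rodrigues n)"
proof (induction k arbitrary: q)
  case (Suc k)
  have "pint (q * (pderiv ^^ Suc k) (rodrigues n)) = - pint (pderiv q * (pderiv ^^ k) (rodrigues n))"
    using Suc.prems rodrigues_pderiv_boundary[of k n] by (simp add: pint_by_parts)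
  thus ?case using Suc by (simp add: funpow_swap1)
qed simp

text \<open>In Rodrigues' formula all $n$ derivatives are moved to the other factor, which they annihilate.\<close>

lemma legendre_orthogonal:
  assumes "degree q < n"
  shows "pint (q * legendre n) = 0"
proof -
  have "(pderiv ^^ n) q = 0"
    using assms
  proof (induction n arbitrary: q)
    case (Suc n)
    show ?case
    proof (cases "degree q = 0")
      case True
      hence "pderiv q = 0" by (simp add: pderiv_eq_0_iff)
      moreover have "(pderiv ^^ n) (0 :: real poly) = 0" by (induction n) auto
      ultimately show ?thesis by (simp add: funpow_swap1)
    next
      case False
      thus ?thesis using Suc by (simp add: funpow_swap1 degree_pderiv)
    qed
  qed simp
  thus ?thesis using rodrigues_by_parts[of n n q] by (simp add: legendre_def pint_smult)
qed

text \<open>The factor $x^2 - 1$ makes the boundary terms vanish when the derivative is moved away from the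
Legendre polynomial; what remains is the orthogonality of the latter. This is what makes the Lobatto
rule exact up to degree $2p - 1$.\<close>

lemma lobatto_orthogonal:
  assumes "degree q + 1 < n"
  shows "pint (q * ([:-1, 0, 1:] * pderiv (legendre n))) = 0"
proof -
  have "pint (q * [:-1, 0, 1:] * pderiv (legendre n)) = - pint (pderiv (q * [:-1, 0, 1:]) * legendre n)"
    by (simp add: pint_by_parts)
  moreover have "degree (pderiv (q * [:-1, 0, 1:])) < n"
    using assms degree_mult_le[of q "[:-1, 0, 1:]"] by (simp add: degree_pderiv)
  hence "pint (pderiv (q * [:-1, 0, 1:]) * legendre n) = 0" by (rule legendre_orthogonal)
  ultimately show ?thesis by (simp only: mult.assoc)
qed

section \<open>Interpolation and quadrature\<close>

lemma poly_eq_if_agree: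
  fixes f g :: "real poly"
  assumes "distinct zs" "degree f < length zs" "degree g < length zs"
    "\<And>i. i < length zs \<Longrightarrow> poly f (zs ! i) = poly g (zs ! i)"
  shows "f = g"
proof (rule ccontr)
  assume "f \<noteq> g"
  hence nz: "f - g \<noteq> 0" by simp
  have "set zs \<subseteq> {x. poly (f - g) x = 0}" using assms(4) by (auto simp: in_set_conv_nth)
  hence "length zs \<le> card {x. poly (f - g) x = 0}"
    using card_mono[OF poly_roots_finite[OF nz]] distinct_card[OF assms(1)] by metis
  also have "\<dots> \<le> degree (f - g)" by (rule card_poly_roots_bound[OF nz])
  also have "\<dots> < length zs" using degree_diff_less[OF assms(2,3)] .
  finally show False by simp
qed

lemma lagrange_poly_node:
  assumes "distinct zs" "i < length zs" "j < length zs"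
  shows "poly (lagrange_poly zs i) (zs ! j) = (if i = j then 1 else 0)"
proof (cases "i = j")
  case True
  thus ?thesis using assms by (auto simp: lagrange_poly_def poly_prod nth_eq_iff_index_eq
      intro!: prod.neutral simp flip: diff_divide_distrib)
next
  case False
  thus ?thesis using assms by (auto simp: lagrange_poly_def poly_prod intro!: bexI[of _ j])
qed

lemma degree_lagrange_poly:
  assumes "i < length zs"
  shows "degree (lagrange_poly zs i) < length zs"
proof -
  have "degree (lagrange_poly zs i) \<le> (\<Sum>j\<in>{..<length zs} - {i}. 1)"
    unfolding lagrange_poly_def
    by (rule order.trans[OF degree_prod_sum_le[OF finite_Diff[OF finite_lessThan]] sum_mono])
       (auto intro: order.trans[OF degree_smult_le])
  also have "\<dots> = length zs - 1" using assms by simp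
  finally show ?thesis using assms by linarith
qed

lemma lagrange_interpolation:
  assumes "distinct zs" "degree f < length zs"
  shows "(\<Sum>i<length zs. Polynomial.smult (poly f (zs ! i)) (lagrange_poly zs i)) = f"
proof (rule poly_eq_if_agree[OF assms(1) _ assms(2)])
  show "degree (\<Sum>i<length zs. Polynomial.smult (poly f (zs ! i)) (lagrange_poly zs i)) < length zs"
    using assms(2) by (intro degree_sum_less) (auto intro: le_less_trans[OF degree_smult_le] degree_lagrange_poly)
next
  fix j assume "j < length zs"
  thus "poly (\<Sum>i<length zs. Polynomial.smult (poly f (zs ! i)) (lagrange_poly zs i)) (zs ! j) = poly f (zs ! j)"
    using assms(1) by (simp add: poly_sum lagrange_poly_node if_distrib cong: if_cong)
qed

text \<open>The classical principle behind Gauss-type rules: division by the node polynomial $\omega$ splits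
$f = q \omega + r$. The remainder $r$ is reproduced by interpolation, while $q \omega$ vanishes at the
nodes and has integral 0 by orthogonality. So exactness extends as far as the orthogonality of
$\omega$ does.\<close>

lemma quadrature_exact:
  assumes "distinct zs" "degree \<omega> = length zs" "zs \<noteq> []"
    "\<And>i. i < length zs \<Longrightarrow> poly \<omega> (zs ! i) = 0"
    "\<And>q. degree q + length zs \<le> m \<Longrightarrow> pint (q * \<omega>) = 0"
    "degree f \<le> m"
  shows "(\<Sum>i<length zs. quad_weight zs i * poly f (zs ! i)) = pint f"
proof -
  define r where "r = f mod \<omega>"
  have nz: "\<omega> \<noteq> 0" using assms(2,3) by auto
  have f: "f = (f div \<omega>) * \<omega> + r" by (simp add: r_def)
  have "pint ((f div \<omega>) * \<omega>) = 0"
  proof (cases "f div \<omega> = 0")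
    case False
    hence deg: "degree ((f div \<omega>) * \<omega>) = degree (f div \<omega>) + length zs"
      using nz assms(2) by (simp add: degree_mult_eq)
    have "degree r < length zs"
      using degree_mod_less[OF nz, of f] assms(2,3) by (auto simp: r_def)
    hence "degree f = degree (f div \<omega>) + length zs"
      using deg by (subst f) (simp add: degree_add_eq_left)
    thus ?thesis using assms(5,6) by simp
  qed simp
  hence "pint f = pint r" by (subst f) (simp add: pint_add)
  also have "degree r < length zs"
    using degree_mod_less[OF nz, of f] assms(2,3) by (auto simp: r_def)
  hence "pint r = pint (\<Sum>i<length zs. Polynomial.smult (poly r (zs ! i)) (lagrange_poly zs i))"
    using lagrange_interpolation[OF assms(1)] by simp
  also have "\<dots> = (\<Sum>i<length zs. quad_weight zs i * poly r (zs ! i))"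
    by (simp add: pint_sum pint_smult quad_weight_def mult.commute flip: pint_def)
  also have "\<dots> = (\<Sum>i<length zs. quad_weight zs i * poly f (zs ! i))"
  proof (rule sum.cong[OF refl])
    fix i assume "i \<in> {..<length zs}"
    thus "quad_weight zs i * poly r (zs ! i) = quad_weight zs i * poly f (zs ! i)"
      using assms(4) arg_cong[OF f, of "\<lambda>h. poly h (zs ! i)"] by simp
  qed
  finally show ?thesis by simp
qed

text \<open>A weight is isolated by testing the rule with a nonnegative polynomial that vanishes at all other
nodes. For Gauss and Lobatto rules such polynomials exist within the degree of exactness.\<close>

lemma quad_weight_pos:
  assumes "(\<Sum>j<length zs. quad_weight zs j * poly g (zs ! j)) = pint g"
    and "i < length zs" "\<And>j. j < length zs \<Longrightarrow> j \<noteq> i \<Longrightarrow> poly g (zs ! j) = 0"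
    and "poly g (zs ! i) > 0" "\<And>x. x \<in> {-1..1} \<Longrightarrow> 0 \<le> poly g x"
  shows "quad_weight zs i > 0"
proof -
  have "0 < pint g" using assms by (intro pint_pos) auto
  also have "pint g = (\<Sum>j<length zs. if j = i then quad_weight zs i * poly g (zs ! i) else 0)"
    unfolding assms(1)[symmetric] using assms(3) by (intro sum.cong) auto
  also have "\<dots> = quad_weight zs i * poly g (zs ! i)" using assms(2) by simp
  finally show ?thesis using assms(4) by (simp add: zero_less_mult_iff)
qed

definition node_poly :: "real set \<Rightarrow> real poly" where
  "node_poly S = (\<Prod>y\<in>S. [:-y, 1:])"

lemma poly_node_poly: "finite S \<Longrightarrow> poly (node_poly S) x = 0 \<longleftrightarrow> x \<in> S"
  by (auto simp: node_poly_def poly_prod)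

lemma degree_node_poly: "degree (node_poly S) = card S"
  by (simp add: node_poly_def degree_prod_eq_sum_degree)

lemma gauss_nodes:
  "distinct (gauss_nodes p)" "length (gauss_nodes p) = p + 1"
  "set (gauss_nodes p) = {x. poly (legendre (p + 1)) x = 0}"
  using legendre_roots(1)[of "p + 1"] poly_roots_finite[OF legendre_nz, of "p + 1"]
  by (auto simp: gauss_nodes_def)

lemma gauss_exact:
  assumes "degree f \<le> 2 * p + 1"
  shows "(\<Sum>i<p + 1. quad_weight (gauss_nodes p) i * poly f (gauss_nodes p ! i)) = pint f"
proof -
  have "(\<Sum>i<length (gauss_nodes p). quad_weight (gauss_nodes p) i * poly f (gauss_nodes p ! i)) = pint f"
  proof (rule quadrature_exact[where m = "2 * p + 1" and \<omega> = "legendre (p + 1)"])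
    fix i assume "i < length (gauss_nodes p)"
    thus "poly (legendre (p + 1)) (gauss_nodes p ! i) = 0"
      using nth_mem[of i "gauss_nodes p"] gauss_nodes(3) by auto
  next
    fix q :: "real poly" assume "degree q + length (gauss_nodes p) \<le> 2 * p + 1"
    thus "pint (q * legendre (p + 1)) = 0" by (intro legendre_orthogonal) (simp add: gauss_nodes)
  qed (use assms gauss_nodes[of p] in auto)
  thus ?thesis by (simp add: gauss_nodes)
qed

lemma gauss_weight_pos:
  assumes "i \<le> p"
  shows "quad_weight (gauss_nodes p) i > 0"
proof -
  let ?zs = "gauss_nodes p"
  define S where "S = set ?zs - {?zs ! i}"
  have fin: "finite S" by (simp add: S_def)
  have "?zs ! i \<in> set ?zs" using assms by (intro nth_mem) (simp add: gauss_nodes)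
  hence card: "card S = p"
    using distinct_card[OF gauss_nodes(1)[of p]] by (simp add: S_def gauss_nodes)
  show ?thesis
  proof (rule quad_weight_pos[where g = "node_poly S * node_poly S"])
    \<comment> \<open>Squaring makes the test polynomial nonnegative; degree $2p$ is within the exactness of the rule.\<close>
    have "degree (node_poly S * node_poly S) \<le> 2 * p + 1"
      using degree_mult_le[of "node_poly S" "node_poly S"] by (simp add: degree_node_poly card)
    thus "(\<Sum>j<length ?zs. quad_weight ?zs j * poly (node_poly S * node_poly S) (?zs ! j))
            = pint (node_poly S * node_poly S)"
      unfolding gauss_nodes(2) by (rule gauss_exact)
  next
    fix j assume j: "j < length ?zs" "j \<noteq> i"
    hence "?zs ! j \<in> S"
      using gauss_nodes(1)[of p] assms by (auto simp: S_def nth_eq_iff_index_eq gauss_nodes(2))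
    thus "poly (node_poly S * node_poly S) (?zs ! j) = 0"
      using fin by (simp add: poly_node_poly)
  next
    have "poly (node_poly S) (?zs ! i) \<noteq> 0" using fin by (subst poly_node_poly) (auto simp: S_def)
    thus "poly (node_poly S * node_poly S) (?zs ! i) > 0" by (auto simp: zero_less_mult_iff)
  qed (use assms in \<open>auto simp: gauss_nodes\<close>)
qed

lemma lobatto_nodes:
  assumes "p \<ge> 1"
  shows "distinct (lobatto_nodes p)" "length (lobatto_nodes p) = p + 1"
    "set (lobatto_nodes p) = {-1, 1} \<union> {x. poly (pderiv (legendre p)) x = 0}"
proof -
  define A where "A = {-1, 1} \<union> {x. poly (pderiv (legendre p)) x = 0}"
  have "pderiv (legendre p) \<noteq> 0" using assms by (simp add: pderiv_eq_0_iff)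
  hence roots: "finite {x. poly (pderiv (legendre p)) x = 0}" by (rule poly_roots_finite)
  hence "finite A" by (simp add: A_def)
  moreover have "{-1, 1} \<inter> {x. poly (pderiv (legendre p)) x = 0} = {}"
    using pderiv_legendre_roots(2)[OF assms] by auto
  hence "card A = p + 1"
    unfolding A_def using roots assms
    by (subst card_Un_disjoint) (simp_all add: pderiv_legendre_roots(1)[OF assms])
  ultimately show "distinct (lobatto_nodes p)" "length (lobatto_nodes p) = p + 1"
    "set (lobatto_nodes p) = {-1, 1} \<union> {x. poly (pderiv (legendre p)) x = 0}"
    unfolding lobatto_nodes_def A_def[symmetric] by simp_all
qed

lemma lobatto_exact:
  assumes "p \<ge> 1" "degree f \<le> 2 * p - 1"
  shows "(\<Sum>i<p + 1. quad_weight (lobatto_nodes p) i * poly f (lobatto_nodes p ! i)) = pint f"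
proof -
  let ?\<omega> = "[:-1, 0, 1:] * pderiv (legendre p)"
  have nz: "pderiv (legendre p) \<noteq> 0" using assms by (simp add: pderiv_eq_0_iff)
  have "(\<Sum>i<length (lobatto_nodes p). quad_weight (lobatto_nodes p) i * poly f (lobatto_nodes p ! i)) = pint f"
  proof (rule quadrature_exact[where m = "2 * p - 1" and \<omega> = ?\<omega>])
    show "degree ?\<omega> = length (lobatto_nodes p)"
      using nz assms by (subst degree_mult_eq) (auto simp: degree_pderiv lobatto_nodes)
  next
    fix i assume "i < length (lobatto_nodes p)"
    thus "poly ?\<omega> (lobatto_nodes p ! i) = 0"
      using nth_mem[of i "lobatto_nodes p"] lobatto_nodes(3)[OF assms(1)] by auto
  next
    fix q :: "real poly" assume "degree q + length (lobatto_nodes p) \<le> 2 * p - 1"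
    thus "pint (q * ?\<omega>) = 0" using assms(1) by (intro lobatto_orthogonal) (simp add: lobatto_nodes)
  qed (use assms lobatto_nodes[of p] in auto)
  thus ?thesis using assms(1) by (simp add: lobatto_nodes)
qed

text \<open>The square of a Lagrange polynomial has degree $2p$, one too many for the Lobatto rule. Since the end
points are boundary points of the interval, a simple zero there does not change the sign inside; only
the interior nodes have to be squared, which brings the degree down to at most $2p - 1$.\<close>

lemma lobatto_weight_pos:
  assumes "p \<ge> 1" "i \<le> p"
  shows "quad_weight (lobatto_nodes p) i > 0"
proof -
  let ?zs = "lobatto_nodes p"
  let ?z = "?zs ! i"
  define N where "N = {x. poly (pderiv (legendre p)) x = 0}"
  define S where "S = N - {?z}"
  \<comment> \<open>The factor that vanishes at those end points different from the chosen node.\<close>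
  define e :: "real poly" where
    "e = (if ?z = 1 then [:1, 1:] else if ?z = -1 then [:1, -1:] else [:1, 0, -1:])"
  define g where "g = e * (node_poly S * node_poly S)"
  have N: "card N = p - 1" "N \<subseteq> {-1<..<1}"
    unfolding N_def using pderiv_legendre_roots[OF assms(1)] by auto
  have "pderiv (legendre p) \<noteq> 0" using assms by (simp add: pderiv_eq_0_iff)
  hence finN: "finite N" unfolding N_def by (rule poly_roots_finite)
  hence fin: "finite S" by (simp add: S_def)
  have zs: "set ?zs = {-1, 1} \<union> N" using lobatto_nodes(3)[OF assms(1)] by (simp add: N_def)
  have "?z \<in> set ?zs" using assms by (intro nth_mem) (simp add: lobatto_nodes)
  hence z: "?z = -1 \<or> ?z = 1 \<or> ?z \<in> N" using zs by auto
  have deg: "degree g \<le> 2 * p - 1"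
  proof -
    have "degree g \<le> degree e + (card S + card S)"
      unfolding g_def using degree_mult_le[of e "node_poly S * node_poly S"]
        degree_mult_le[of "node_poly S" "node_poly S"] by (simp add: degree_node_poly)
    also have "\<dots> \<le> 2 * p - 1"
    proof (cases "?z \<in> N")
      case True
      hence "card S = p - 2" "?z \<noteq> 1" "?z \<noteq> -1"
        using N finN by (auto simp: S_def)
      moreover have "card N > 0" using True finN by (auto simp: card_gt_0_iff)
      hence "p \<ge> 2" using N(1) by linarith
      ultimately show ?thesis by (simp add: e_def)
    next
      case False
      hence "?z = -1 \<or> ?z = 1" "card S = p - 1" using N z by (auto simp: S_def)
      thus ?thesis using assms by (auto simp: e_def)
    qed
    finally show ?thesis .
  qed
  have e_nonneg: "poly e x \<ge> 0" if "x \<in> {-1..1}" for x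
  proof -
    have "x\<^sup>2 \<le> 1" using that by (simp add: abs_square_le_1 abs_le_iff)
    thus ?thesis using that by (simp add: e_def power2_eq_square)
  qed
  have e_pos_at_node: "poly e ?z > 0"
  proof (cases "?z \<in> N")
    case True
    hence z': "-1 < ?z" "?z < 1" using N by auto
    hence "poly e ?z = (1 - ?z) * (1 + ?z)" by (simp add: e_def algebra_simps)
    thus ?thesis using z' by simp
  next
    case False
    thus ?thesis using z by (auto simp: e_def)
  qed
  show ?thesis
  proof (rule quad_weight_pos[where g = g])
    show "(\<Sum>j<length ?zs. quad_weight ?zs j * poly g (?zs ! j)) = pint g"
      using lobatto_exact[OF assms(1) deg] assms(1) by (simp add: lobatto_nodes)
  next
    fix j assume j: "j < length ?zs" "j \<noteq> i"
    hence ne: "?zs ! j \<noteq> ?z"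
      using lobatto_nodes(1,2)[OF assms(1)] assms by (simp add: nth_eq_iff_index_eq)
    have "?zs ! j \<in> set ?zs" using j by simp
    hence "?zs ! j \<in> S \<or> poly e (?zs ! j) = 0"
      using zs ne by (auto simp: S_def e_def)
    thus "poly g (?zs ! j) = 0" using fin by (auto simp: g_def poly_node_poly)
  next
    have "poly (node_poly S) ?z \<noteq> 0" using fin by (subst poly_node_poly) (auto simp: S_def)
    thus "poly g ?z > 0" using e_pos_at_node by (auto simp: g_def zero_less_mult_iff)
  next
    fix x :: real assume "x \<in> {-1..1}"
    thus "0 \<le> poly g x" using e_nonneg by (simp add: g_def)
  qed (use assms in \<open>auto simp: lobatto_nodes\<close>)
qed

section \<open>The three bases and their dual coordinates\<close>

lemma legendre_gram:
  "pint (legendre i * legendre j) = (if i = j then pint (legendre i * legendre i) else 0)"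
proof (cases i j rule: linorder_cases)
  case less
  thus ?thesis using legendre_orthogonal[of "legendre i" j] by simp
next
  case greater
  thus ?thesis using legendre_orthogonal[of "legendre j" i] by (simp add: mult.commute)
qed simp

text \<open>The leading term is cancelled by a multiple of the Legendre polynomial of the same degree.\<close>

lemma legendre_span:
  "degree f \<le> p \<Longrightarrow> \<exists>c. f = (\<Sum>i\<le>p. Polynomial.smult (c i) (legendre i))"
proof (induction p arbitrary: f)
  case 0
  hence "f = (\<Sum>i\<le>0. Polynomial.smult (coeff f 0) (legendre i))"
    by (auto simp: legendre_0 elim: degree_eq_zeroE)
  thus ?case by (intro exI[of _ "\<lambda>_. coeff f 0"])
next
  case (Suc p)
  define a where "a = coeff f (Suc p) / coeff (legendre (Suc p)) (Suc p)"
  define g where "g = f - Polynomial.smult a (legendre (Suc p))"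
  have lc: "coeff (legendre (Suc p)) (Suc p) \<noteq> 0"
    using leading_coeff_0_iff[of "legendre (Suc p)"] by simp
  have "degree g \<le> p"
  proof (rule degree_le, intro allI impI)
    fix i assume "p < i"
    then consider "i = Suc p" | "i > Suc p" by linarith
    thus "coeff g i = 0"
      by cases (use lc Suc.prems in \<open>auto simp: g_def a_def coeff_eq_0\<close>)
  qed
  then obtain c where "g = (\<Sum>i\<le>p. Polynomial.smult (c i) (legendre i))" using Suc.IH by blast
  hence "f = (\<Sum>i\<le>Suc p. Polynomial.smult ((c(Suc p := a)) i) (legendre i))"
    by (simp add: g_def algebra_simps)
  thus ?case by blast
qed

text \<open>For $p = 0$ the two Lobatto end points could not be distinct nodes of a rule with $p + 1$ nodes.\<close>

definition admissible :: "basis_kind \<Rightarrow> nat \<Rightarrow> bool" where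
  "admissible b p \<longleftrightarrow> (b = Gauss_Lobatto \<longrightarrow> p \<ge> 1)"

fun weight :: "basis_kind \<Rightarrow> nat \<Rightarrow> nat \<Rightarrow> real" where
  "weight Gauss_Lobatto p i = quad_weight (lobatto_nodes p) i"
| "weight Gauss_Legendre p i = quad_weight (gauss_nodes p) i"
| "weight Modal_Legendre p i = pint (legendre i * legendre i)"

text \<open>The functionals dual to the basis polynomials: point evaluation for the nodal bases, Fourier-Legendre
coefficients for the modal basis. They are defined on all polynomials, not just on those of degree at
most $p$. On a product of higher degree they therefore perform interpolation or $L^2$ projection,
respectively, which is precisely the discrete multiplication of the three bases. This allows the three
cases to be treated by the same formulas from here on.\<close>

fun coord :: "basis_kind \<Rightarrow> nat \<Rightarrow> nat \<Rightarrow> real poly \<Rightarrow> real" where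
  "coord Gauss_Lobatto p i f = poly f (lobatto_nodes p ! i)"
| "coord Gauss_Legendre p i f = poly f (gauss_nodes p ! i)"
| "coord Modal_Legendre p i f = pint (f * legendre i) / pint (legendre i * legendre i)"

lemma coord_sum:
  "coord b p i (\<Sum>j\<in>A. Polynomial.smult (c j) (f j)) = (\<Sum>j\<in>A. c j * coord b p i (f j))"
  by (cases b) (simp_all add: poly_sum sum_distrib_right pint_sum pint_smult sum_divide_distrib)

lemma weight_pos: "admissible b p \<Longrightarrow> i \<le> p \<Longrightarrow> weight b p i > 0"
  by (cases b) (simp_all add: admissible_def lobatto_weight_pos gauss_weight_pos pint_square_pos)

lemma coord_basis:
  assumes "admissible b p" "i \<le> p" "j \<le> p"
  shows "coord b p i (basis_poly b p j) = (if i = j then 1 else 0)"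
proof (cases b)
  case Modal_Legendre
  thus ?thesis using legendre_gram[of j i] pint_square_pos[OF legendre_nz, of i] by (cases "i = j") auto
qed (use assms lagrange_poly_node[of "lobatto_nodes p" j i] lagrange_poly_node[of "gauss_nodes p" j i] in
      \<open>auto simp: admissible_def lobatto_nodes gauss_nodes\<close>)

lemma degree_basis_poly:
  assumes "admissible b p" "i \<le> p"
  shows "degree (basis_poly b p i) \<le> p"
  using assms degree_lagrange_poly[of i "lobatto_nodes p"] degree_lagrange_poly[of i "gauss_nodes p"]
  by (cases b) (auto simp: admissible_def lobatto_nodes gauss_nodes)

lemma coord_expansion:
  assumes "admissible b p" "degree f \<le> p"
  shows "(\<Sum>i\<le>p. Polynomial.smult (coord b p i f) (basis_poly b p i)) = f"
proof (cases b)
  case Modal_Legendre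
  obtain c where c: "f = (\<Sum>i\<le>p. Polynomial.smult (c i) (basis_poly b p i))"
    using legendre_span[OF assms(2)] Modal_Legendre by auto
  have "coord b p i f = c i" if "i \<le> p" for i
  proof -
    have "coord b p i f = (\<Sum>j\<le>p. c j * (if i = j then 1 else 0))"
      unfolding c coord_sum using that assms(1) by (intro sum.cong) (auto simp: coord_basis)
    thus ?thesis using that by (simp add: if_distrib cong: if_cong)
  qed
  thus ?thesis by (subst (2) c) (intro sum.cong, auto)
qed (use assms lagrange_interpolation[of "lobatto_nodes p" f] lagrange_interpolation[of "gauss_nodes p" f] in
      \<open>auto simp: admissible_def lobatto_nodes gauss_nodes lessThan_Suc_atMost\<close>)

text \<open>The discrete inner product agrees with the exact one as soon as one factor loses a degree, as a
derivative does. The three reasons differ: orthogonality of the modal basis, and exactness of degree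
$2p - 1$ and $2p + 1$ of the two quadrature rules.\<close>

lemma weighted_coords_eq_pint:
  assumes "admissible b p" "degree f \<le> p" "degree g \<le> p - 1"
  shows "(\<Sum>i\<le>p. weight b p i * coord b p i f * coord b p i g) = pint (f * g)"
proof (cases b)
  case Modal_Legendre
  \<comment> \<open>Expanding $f$ turns the integral into the coefficients of $g$ times the Gram entries.\<close>
  have "pint (f * g) = (\<Sum>i\<le>p. coord b p i f * pint (legendre i * g))"
    by (subst coord_expansion[OF assms(1,2), symmetric])
       (simp add: sum_distrib_right pint_sum pint_smult Modal_Legendre)
  also have "\<dots> = (\<Sum>i\<le>p. weight b p i * coord b p i f * coord b p i g)"
    using pint_square_pos[OF legendre_nz]
    by (intro sum.cong) (auto simp: Modal_Legendre mult.commute less_le)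
  finally show ?thesis by simp
next
  case Gauss_Lobatto
  have "degree (f * g) \<le> 2 * p - 1" "p \<ge> 1"
    using assms degree_mult_le[of f g] Gauss_Lobatto by (auto simp: admissible_def)
  thus ?thesis using lobatto_exact[of p "f * g"] Gauss_Lobatto
    by (simp add: lessThan_Suc_atMost mult.assoc)
next
  case Gauss_Legendre
  have "degree (f * g) \<le> 2 * p + 1"
    using assms degree_mult_le[of f g] by auto
  thus ?thesis using gauss_exact[of "f * g" p] Gauss_Legendre
    by (simp add: lessThan_Suc_atMost mult.assoc)
qed

lemma degree_poly_of_coeffs:
  assumes "admissible b p"
  shows "degree (poly_of_coeffs b p v) \<le> p"
  unfolding poly_of_coeffs_def using degree_basis_poly[OF assms]
  by (intro degree_sum_le) (auto intro: order.trans[OF degree_smult_le])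

lemma coord_poly_of_coeffs:
  assumes "admissible b p" "i \<le> p"
  shows "coord b p i (poly_of_coeffs b p v) = v $ i"
proof -
  have "coord b p i (poly_of_coeffs b p v) = (\<Sum>j\<le>p. v $ j * (if i = j then 1 else 0))"
    unfolding poly_of_coeffs_def coord_sum using assms by (intro sum.cong) (auto simp: coord_basis)
  thus ?thesis using assms by (simp add: if_distrib cong: if_cong)
qed

definition coords :: "basis_kind \<Rightarrow> nat \<Rightarrow> real poly \<Rightarrow> real vec" where
  "coords b p f = vec (p + 1) (\<lambda>i. coord b p i f)"

lemma coords_carrier [simp]: "coords b p f \<in> carrier_vec (Suc p)"
  by (simp add: coords_def)

lemma coords_index [simp]: "i \<le> p \<Longrightarrow> coords b p f $ i = coord b p i f"
  by (simp add: coords_def)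

lemma coords_poly_of_coeffs:
  assumes "admissible b p" "v \<in> carrier_vec (p + 1)"
  shows "coords b p (poly_of_coeffs b p v) = v"
  using assms by (intro eq_vecI) (auto simp: coords_def coord_poly_of_coeffs)

lemma poly_of_coeffs_coords:
  assumes "admissible b p" "degree f \<le> p"
  shows "poly_of_coeffs b p (coords b p f) = f"
  using coord_expansion[OF assms] by (simp add: poly_of_coeffs_def)

lemma coeff_vec_eq_coords:
  assumes "admissible b p" "degree f \<le> p"
  shows "coeff_vec b p f = coords b p f"
  unfolding coeff_vec_def using assms
  by (intro the_equality) (auto simp: poly_of_coeffs_coords coords_poly_of_coeffs)

lemma mult_mat_vec_index:
  assumes "w \<in> carrier_vec (Suc p)" "i < m"
  shows "(mat m (Suc p) f *\<^sub>v w) $ i = (\<Sum>j\<le>p. f (i, j) * w $ j)"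
  using assms by (simp add: scalar_prod_def atLeast0LessThan lessThan_Suc_atMost)

lemma diagonal_mat_mult_vec:
  assumes "w \<in> carrier_vec (Suc p)"
  shows "mat (Suc p) (Suc p) (\<lambda>(i, j). if i = j then d i else 0) *\<^sub>v w
           = vec (Suc p) (\<lambda>i. d i * w $ i)"
proof (rule eq_vecI)
  fix i assume "i < dim_vec (vec (Suc p) (\<lambda>i. d i * w $ i))"
  hence i: "i < Suc p" by simp
  have "(mat (Suc p) (Suc p) (\<lambda>(i, j). if i = j then d i else 0) *\<^sub>v w) $ i
          = (\<Sum>j\<le>p. if j = i then d i * w $ i else 0)"
    unfolding mult_mat_vec_index[OF assms i] by (intro sum.cong) auto
  thus "(mat (Suc p) (Suc p) (\<lambda>(i, j). if i = j then d i else 0) *\<^sub>v w) $ i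
          = vec (Suc p) (\<lambda>i. d i * w $ i) $ i"
    using i by (simp del: index_mult_mat_vec)
qed simp

lemma scalar_prod_vec: "v \<bullet> vec (Suc p) f = (\<Sum>i\<le>p. v $ i * f i)"
  by (simp add: scalar_prod_def atLeast0LessThan lessThan_Suc_atMost)

lemma matrix_of_mult_vec:
  assumes "admissible b p" "w \<in> carrier_vec (p + 1)"
    and "\<And>j. j \<le> p \<Longrightarrow> degree (F (basis_poly b p j)) \<le> p"
  shows "matrix_of b p F *\<^sub>v w
           = coords b p (\<Sum>j\<le>p. Polynomial.smult (w $ j) (F (basis_poly b p j)))"
proof (rule eq_vecI)
  fix i assume "i < dim_vec (coords b p (\<Sum>j\<le>p. Polynomial.smult (w $ j) (F (basis_poly b p j))))"
  thus "(matrix_of b p F *\<^sub>v w) $ i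
          = coords b p (\<Sum>j\<le>p. Polynomial.smult (w $ j) (F (basis_poly b p j))) $ i"
    using assms by (simp add: matrix_of_def mult_mat_vec_index coords_def coord_sum mult.commute
        coeff_vec_eq_coords[unfolded coords_def] del: index_mult_mat_vec)
qed (simp add: matrix_of_def coords_def)

lemma ref_deriv_mult_vec:
  assumes "admissible b p" "w \<in> carrier_vec (p + 1)"
  shows "ref_deriv b p *\<^sub>v w = coords b p (pderiv (poly_of_coeffs b p w))"
proof -
  have "degree (pderiv (basis_poly b p j)) \<le> p" if "j \<le> p" for j
    using degree_basis_poly[OF assms(1) that] by (simp add: degree_pderiv)
  hence "ref_deriv b p *\<^sub>v w = coords b p (\<Sum>j\<le>p. Polynomial.smult (w $ j) (pderiv (basis_poly b p j)))"
    unfolding ref_deriv_def using assms by (intro matrix_of_mult_vec)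
  thus ?thesis
    by (simp add: poly_of_coeffs_def pderiv_smult higher_pderiv_sum[of 1, simplified])
qed

text \<open>The truncated Legendre expansion satisfies the defining orthogonality; two candidates differ by a
polynomial orthogonal to itself.\<close>

lemma l2_proj_eq:
  "l2_proj p q = poly_of_coeffs Modal_Legendre p (coords Modal_Legendre p q)"
  unfolding l2_proj_def
proof (rule the_equality)
  let ?b = Modal_Legendre
  have adm: "admissible ?b p" by (simp add: admissible_def)
  let ?r = "poly_of_coeffs ?b p (coords ?b p q)"
  have int: "integral {-1..1} (\<lambda>x. (poly q x - poly r x) * poly s x) = pint ((q - r) * s)" for r s
    by (simp add: pint_def poly_mult[abs_def] poly_diff[abs_def])
  have orth: "pint ((q - ?r) * s) = 0" if deg: "degree s \<le> p" for s
  proof -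
    have "pint ((q - ?r) * legendre i) = 0" if "i \<le> p" for i
    proof -
      have "coord ?b p i ?r = coord ?b p i q" using coord_poly_of_coeffs[OF adm that] that by simp
      thus ?thesis using pint_square_pos[OF legendre_nz, of i]
        by (simp add: left_diff_distrib pint_diff)
    qed
    moreover obtain c where "s = (\<Sum>i\<le>p. Polynomial.smult (c i) (legendre i))"
      using legendre_span[OF deg] by blast
    ultimately show ?thesis by (simp add: sum_distrib_left pint_sum pint_smult)
  qed
  show "degree ?r \<le> p \<and>
     (\<forall>s. degree s \<le> p \<longrightarrow> integral {-1..1} (\<lambda>x. (poly q x - poly ?r x) * poly s x) = 0)"
    using degree_poly_of_coeffs[OF adm] orth unfolding int by blast
  fix r assume r: "degree r \<le> p \<and>
     (\<forall>s. degree s \<le> p \<longrightarrow> integral {-1..1} (\<lambda>x. (poly q x - poly r x) * poly s x) = 0)"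
  define d where "d = r - ?r"
  have "degree d \<le> p" unfolding d_def using r degree_poly_of_coeffs[OF adm] by (intro degree_diff_le) auto
  hence "pint ((q - ?r) * d) = 0" "pint ((q - r) * d) = 0" using orth r unfolding int by auto
  hence "pint ((q - ?r) * d - (q - r) * d) = 0" by (simp add: pint_diff)
  also have "(q - ?r) * d - (q - r) * d = d * d" by (simp add: d_def algebra_simps)
  finally have "d = 0" using pint_square_pos[of d] by force
  thus "r = ?r" by (simp add: d_def)
qed

text \<open>In this form the commutativity of the discrete product, and the fact that the constant 1 is its unit,
are evident for all three bases.\<close>

lemma disc_prod_eq_coords:
  assumes "admissible b p" "v \<in> carrier_vec (p + 1)" "w \<in> carrier_vec (p + 1)"
  shows "disc_prod b p v w = coords b p (poly_of_coeffs b p v * poly_of_coeffs b p w)"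
proof (cases "b = Modal_Legendre")
  case True
  let ?F = "\<lambda>w. l2_proj p (poly_of_coeffs b p v * w)"
  let ?S = "\<Sum>j\<le>p. Polynomial.smult (w $ j) (?F (basis_poly b p j))"
  have adm: "admissible Modal_Legendre p" by (simp add: admissible_def)
  have "disc_prod b p v w = coords b p ?S"
    unfolding disc_prod_def using assms(1,3) degree_poly_of_coeffs[OF assms(1)]
    by (subst matrix_of_mult_vec[symmetric]) (auto simp: True l2_proj_eq)
  also have "\<dots> = coords b p (\<Sum>j\<le>p. Polynomial.smult (w $ j) (poly_of_coeffs b p v * basis_poly b p j))"
    unfolding coords_def coord_sum
    by (intro eq_vecI) (auto simp: True l2_proj_eq coord_poly_of_coeffs[OF adm] intro!: sum.cong
        simp del: coord.simps)
  also have "(\<Sum>j\<le>p. Polynomial.smult (w $ j) (poly_of_coeffs b p v * basis_poly b p j))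
               = poly_of_coeffs b p v * poly_of_coeffs b p w"
    by (simp add: poly_of_coeffs_def sum_distrib_left)
  finally show ?thesis .
next
  case False
  have diag: "nodal_mult zs p f *\<^sub>v w = vec (p + 1) (\<lambda>i. poly f (zs ! i) * w $ i)" for zs f
    using diagonal_mat_mult_vec[of w p "\<lambda>i. poly f (zs ! i)"] assms(3) by (simp add: nodal_mult_def)
  have w: "w $ i = coord b p i (poly_of_coeffs b p w)" if "i \<le> p" for i
    using coord_poly_of_coeffs[OF assms(1) that] by simp
  show ?thesis
    using False by (cases b) (auto simp: disc_prod_def diag coords_def w intro!: eq_vecI)
qed

lemma ref_mass_diagonal:
  "ref_mass b p = mat (p + 1) (p + 1) (\<lambda>(i, j). if i = j then weight b p i else 0)"
proof (cases b)
  case Modal_Legendre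
  have "integral {-1..1} (\<lambda>x. poly (legendre i) x * poly (legendre j) x)
          = (if i = j then pint (legendre i * legendre i) else 0)" for i j
    using legendre_gram[of i j] by (simp add: pint_def poly_mult[abs_def])
  thus ?thesis using Modal_Legendre by (simp cong: if_cong)
qed (simp_all add: nodal_mass_def cong: if_cong)

lemma ref_mass_mult_vec:
  assumes "w \<in> carrier_vec (p + 1)"
  shows "ref_mass b p *\<^sub>v w = vec (p + 1) (\<lambda>i. weight b p i * w $ i)"
  using diagonal_mat_mult_vec[of w p "weight b p"] assms by (simp add: ref_mass_diagonal)

text \<open>The stiffness form is computed exactly, although the mass matrix may come from a quadrature rule that
does not integrate products of two polynomials of degree $p$ exactly.\<close>

lemma mass_deriv_form:
  assumes "admissible b p" "v \<in> carrier_vec (p + 1)" "w \<in> carrier_vec (p + 1)"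
  shows "v \<bullet> (ref_mass b p *\<^sub>v (ref_deriv b p *\<^sub>v w))
           = pint (poly_of_coeffs b p v * pderiv (poly_of_coeffs b p w))"
proof -
  have "v \<bullet> (ref_mass b p *\<^sub>v (ref_deriv b p *\<^sub>v w))
          = (\<Sum>i\<le>p. weight b p i * coord b p i (poly_of_coeffs b p v)
                    * coord b p i (pderiv (poly_of_coeffs b p w)))"
    using assms by (simp add: ref_deriv_mult_vec ref_mass_mult_vec scalar_prod_vec
        coord_poly_of_coeffs ac_simps)
  also have "\<dots> = pint (poly_of_coeffs b p v * pderiv (poly_of_coeffs b p w))"
    using degree_poly_of_coeffs[OF assms(1)] assms(1)
    by (intro weighted_coords_eq_pint) (auto simp: degree_pderiv diff_le_mono)
  finally show ?thesis .
qed

lemma restr_mat_mult_vec: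
  assumes "v \<in> carrier_vec (p + 1)"
  shows "(restr_mat b p *\<^sub>v v) $ 0 = poly (poly_of_coeffs b p v) (-1)"
    "(restr_mat b p *\<^sub>v v) $ 1 = poly (poly_of_coeffs b p v) 1"
  using assms unfolding restr_mat_def
  by (simp_all add: mult_mat_vec_index poly_of_coeffs_def poly_sum mult.commute del: index_mult_mat_vec)

section \<open>Sums weighted with triple products\<close>

lemma triple_E_swap12: "triple_E i j k = triple_E j i k"
  by (simp add: triple_E_def mult.commute)

lemma triple_E_swap13: "triple_E i j k = triple_E k j i"
  by (simp add: triple_E_def mult.commute mult.left_commute)

definition chaos_form :: "nat \<Rightarrow> nat \<Rightarrow> (nat \<Rightarrow> nat \<Rightarrow> real) \<Rightarrow> real" where
  "chaos_form M k h = (\<Sum>i\<le>M. \<Sum>j\<le>M. triple_E i j k * h i j)"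

lemma chaos_form_add: "chaos_form M k (\<lambda>i j. g i j + h i j) = chaos_form M k g + chaos_form M k h"
  by (simp add: chaos_form_def distrib_left sum.distrib)

lemma chaos_form_scale: "chaos_form M k (\<lambda>i j. c * h i j) = c * chaos_form M k h"
  by (simp add: chaos_form_def sum_distrib_left mult.left_commute)

lemma chaos_form_diff: "chaos_form M k (\<lambda>i j. g i j - h i j) = chaos_form M k g - chaos_form M k h"
  by (simp add: chaos_form_def right_diff_distrib sum_subtractf)

lemma chaos_form_cong:
  "(\<And>i j. i \<le> M \<Longrightarrow> j \<le> M \<Longrightarrow> g i j = h i j) \<Longrightarrow> chaos_form M k g = chaos_form M k h"
  by (simp add: chaos_form_def)

lemma chaos_form_swap: "chaos_form M k (\<lambda>i j. h j i) = chaos_form M k h"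
  unfolding chaos_form_def by (subst sum.swap) (simp add: triple_E_swap12)

lemma chaos_form_total:
  "(\<Sum>k\<le>M. chaos_form M k (\<lambda>i j. h i j k)) = (\<Sum>i\<le>M. \<Sum>j\<le>M. \<Sum>k\<le>M. triple_E i j k * h i j k)"
proof -
  have "(\<Sum>k\<le>M. chaos_form M k (\<lambda>i j. h i j k)) = (\<Sum>i\<le>M. \<Sum>k\<le>M. \<Sum>j\<le>M. triple_E i j k * h i j k)"
    unfolding chaos_form_def by (rule sum.swap)
  also have "\<dots> = (\<Sum>i\<le>M. \<Sum>j\<le>M. \<Sum>k\<le>M. triple_E i j k * h i j k)"
    by (rule sum.cong[OF refl], rule sum.swap)
  finally show ?thesis .
qed

text \<open>The symmetry of the triple products allows the roles of the tested component $k$ and the component $i$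
to be exchanged once the sum over $k$ is taken.\<close>

lemma chaos_form_total_swap:
  "(\<Sum>k\<le>M. chaos_form M k (\<lambda>i j. h k j i)) = (\<Sum>k\<le>M. chaos_form M k (\<lambda>i j. h i j k))"
proof -
  have "(\<Sum>k\<le>M. chaos_form M k (\<lambda>i j. h k j i)) = (\<Sum>k\<le>M. \<Sum>i\<le>M. \<Sum>j\<le>M. triple_E k j i * h k j i)"
    unfolding chaos_form_def by (simp add: triple_E_swap13)
  also have "\<dots> = (\<Sum>k\<le>M. \<Sum>j\<le>M. \<Sum>i\<le>M. triple_E k j i * h k j i)"
    by (rule sum.cong[OF refl], rule sum.swap)
  also have "\<dots> = (\<Sum>k\<le>M. chaos_form M k (\<lambda>i j. h i j k))"
    by (rule chaos_form_total[symmetric])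
  finally show ?thesis .
qed

lemma chaos_sum_carrier [simp]: "chaos_sum M n k w \<in> carrier_vec n"
  by (simp add: chaos_sum_def)

lemma chaos_sum_index: "l < n \<Longrightarrow> chaos_sum M n k w $ l = chaos_form M k (\<lambda>i j. w i j $ l)"
  by (simp add: chaos_sum_def chaos_form_def)

lemma scalar_prod_chaos_sum:
  assumes "\<And>i j. i \<le> M \<Longrightarrow> j \<le> M \<Longrightarrow> w i j \<in> carrier_vec n"
  shows "v \<bullet> chaos_sum M n k w = chaos_form M k (\<lambda>i j. v \<bullet> w i j)"
proof -
  have "v \<bullet> chaos_sum M n k w
          = (\<Sum>l<n. \<Sum>i\<le>M. \<Sum>j\<le>M. triple_E i j k * (v $ l * w i j $ l))"
    by (simp add: scalar_prod_def chaos_sum_def sum_distrib_left atLeast0LessThan mult.left_commute)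
  also have "\<dots> = (\<Sum>i\<le>M. \<Sum>l<n. \<Sum>j\<le>M. triple_E i j k * (v $ l * w i j $ l))"
    by (rule sum.swap)
  also have "\<dots> = (\<Sum>i\<le>M. \<Sum>j\<le>M. \<Sum>l<n. triple_E i j k * (v $ l * w i j $ l))"
    by (rule sum.cong[OF refl], rule sum.swap)
  also have "\<dots> = chaos_form M k (\<lambda>i j. v \<bullet> w i j)"
    unfolding chaos_form_def
    by (intro sum.cong refl)
       (simp add: scalar_prod_def sum_distrib_left atLeast0LessThan carrier_vecD[OF assms])
  finally show ?thesis .
qed

section \<open>The scheme for abstract summation-by-parts operators\<close>

lemma bdry_mat_carrier: "bdry_mat \<in> carrier_mat 2 2"
  by (simp add: bdry_mat_def)

lemma scalar_prod_bdry_mat: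
  assumes "g \<in> carrier_vec 2"
  shows "r \<bullet> (bdry_mat *\<^sub>v g) = r $ 1 * g $ 1 - r $ 0 * g $ 0"
  using assms by (simp add: scalar_prod_def bdry_mat_def numeral_2_eq_2)

text \<open>The properties of the discrete operators on which conservation and entropy stability rest. The
summation-by-parts property is stated as an identity of bilinear forms, because it is used with test
vectors; the discrete product is given by its multiplication matrices, because the scheme transposes
them.\<close>

locale sbp_operators =
  fixes n :: nat
    and mass mass_inv deriv restr :: "real mat"
    and mult :: "real vec \<Rightarrow> real mat"
    and one :: "real vec"
  assumes mass_carrier: "mass \<in> carrier_mat n n"
    and mass_inv_carrier: "mass_inv \<in> carrier_mat n n"
    and deriv_carrier: "deriv \<in> carrier_mat n n"
    and restr_carrier: "restr \<in> carrier_mat 2 n"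
    and mult_carrier: "\<And>v. v \<in> carrier_vec n \<Longrightarrow> mult v \<in> carrier_mat n n"
    and one_carrier: "one \<in> carrier_vec n"
    and mass_symmetric: "transpose_mat mass = mass"
    and mass_inverse: "mass * mass_inv = 1\<^sub>m n"
    and sbp: "\<And>v w. v \<in> carrier_vec n \<Longrightarrow> w \<in> carrier_vec n \<Longrightarrow>
        v \<bullet> (mass *\<^sub>v (deriv *\<^sub>v w)) + w \<bullet> (mass *\<^sub>v (deriv *\<^sub>v v))
          = (restr *\<^sub>v v) $ 1 * (restr *\<^sub>v w) $ 1 - (restr *\<^sub>v v) $ 0 * (restr *\<^sub>v w) $ 0"
    and deriv_one: "deriv *\<^sub>v one = 0\<^sub>v n"
    and restr_one: "(restr *\<^sub>v one) $ 0 = 1" "(restr *\<^sub>v one) $ 1 = 1"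
    and mult_commute: "\<And>v w. v \<in> carrier_vec n \<Longrightarrow> w \<in> carrier_vec n \<Longrightarrow> mult v *\<^sub>v w = mult w *\<^sub>v v"
    and mult_one: "\<And>v. v \<in> carrier_vec n \<Longrightarrow> mult v *\<^sub>v one = v"
begin

text \<open>The neighbouring elements enter only through the numerical fluxes $f$ at the two ends, which are
arbitrary here; the balance laws of a single element hold for every choice of them.\<close>

definition semidiscrete_rhs :: "nat \<Rightarrow> (nat \<Rightarrow> real vec) \<Rightarrow> real vec \<Rightarrow> nat \<Rightarrow> real vec" where
  "semidiscrete_rhs M U f k =
     (- (1/3)) \<cdot>\<^sub>v chaos_sum M n k (\<lambda>i j.
         deriv *\<^sub>v (mult (U i) *\<^sub>v U j)
         + (mass_inv * transpose_mat (mult (U j)) * mass) *\<^sub>v (deriv *\<^sub>v U i))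
     - mass_inv *\<^sub>v (transpose_mat restr *\<^sub>v (bdry_mat *\<^sub>v
         (f - chaos_sum M 2 k (\<lambda>i j.
            (1/3) \<cdot>\<^sub>v (restr *\<^sub>v (mult (U i) *\<^sub>v U j))
            + (1/6) \<cdot>\<^sub>v hadamard (restr *\<^sub>v U i) (restr *\<^sub>v U j)))))"

lemma mult_vec_carrier [simp]: "v \<in> carrier_vec n \<Longrightarrow> w \<in> carrier_vec n \<Longrightarrow> mult v *\<^sub>v w \<in> carrier_vec n"
  using mult_carrier by (metis mult_mat_vec_carrier)

lemma deriv_vec_carrier [simp]: "v \<in> carrier_vec n \<Longrightarrow> deriv *\<^sub>v v \<in> carrier_vec n"
  using deriv_carrier by (rule mult_mat_vec_carrier)

lemma mass_vec_carrier [simp]: "v \<in> carrier_vec n \<Longrightarrow> mass *\<^sub>v v \<in> carrier_vec n"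
  using mass_carrier by (rule mult_mat_vec_carrier)

lemma restr_vec_carrier [simp]: "v \<in> carrier_vec n \<Longrightarrow> restr *\<^sub>v v \<in> carrier_vec 2"
  using restr_carrier by (rule mult_mat_vec_carrier)

lemma mass_form_symmetric:
  assumes "v \<in> carrier_vec n" "w \<in> carrier_vec n"
  shows "v \<bullet> (mass *\<^sub>v w) = w \<bullet> (mass *\<^sub>v v)"
  using transpose_vec_mult_scalar[OF mass_carrier assms(2,1)] assms
  by (simp add: mass_symmetric comm_scalar_prod[of _ n])

lemma scalar_prod_transpose:
  fixes A :: "real mat"
  assumes "A \<in> carrier_mat m n" "v \<in> carrier_vec n" "y \<in> carrier_vec m"
  shows "v \<bullet> (transpose_mat A *\<^sub>v y) = (A *\<^sub>v v) \<bullet> y"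
proof -
  have "transpose_mat A *\<^sub>v y \<in> carrier_vec n" "A *\<^sub>v v \<in> carrier_vec m"
    using assms by (auto simp: carrier_matD intro!: carrier_vecI)
  thus ?thesis
    using transpose_vec_mult_scalar[OF assms] assms
      comm_scalar_prod[of v n "transpose_mat A *\<^sub>v y"] comm_scalar_prod[of y m "A *\<^sub>v v"] by simp
qed

text \<open>This identity defines the adjoint: under the mass matrix, the multiplication moves to the test vector.\<close>

lemma mass_mult_adjoint:
  assumes "v \<in> carrier_vec n" "y \<in> carrier_vec n"
  shows "mass *\<^sub>v ((mass_inv * transpose_mat (mult v) * mass) *\<^sub>v y)
           = transpose_mat (mult v) *\<^sub>v (mass *\<^sub>v y)"
proof -
  note c = mass_carrier mass_inv_carrier mult_carrier[OF assms(1)]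
  have t: "transpose_mat (mult v) \<in> carrier_mat n n" using c by simp
  have z: "transpose_mat (mult v) *\<^sub>v (mass *\<^sub>v y) \<in> carrier_vec n"
    using t assms by (auto intro: mult_mat_vec_carrier)
  have "(mass_inv * transpose_mat (mult v) * mass) *\<^sub>v y
          = mass_inv *\<^sub>v (transpose_mat (mult v) *\<^sub>v (mass *\<^sub>v y))"
    using c t assms by (simp add: assoc_mult_mat_vec[of _ n n _ n])
  hence "mass *\<^sub>v ((mass_inv * transpose_mat (mult v) * mass) *\<^sub>v y)
          = (mass * mass_inv) *\<^sub>v (transpose_mat (mult v) *\<^sub>v (mass *\<^sub>v y))"
    using c z by (simp add: assoc_mult_mat_vec[of _ n n _ n])
  thus ?thesis using z by (simp add: mass_inverse)
qed

text \<open>The right-hand side tested with a vector $\varphi$. The two volume terms become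
$\varphi^T M D (u_i u_j)$ and $(u_j \varphi)^T M D u_i$, and the lifting matrix $M^{-1} R^T B$ turns the
flux correction into a difference of boundary values weighted with those of $\varphi$.\<close>

lemma rhs_tested:
  assumes \<phi>: "\<phi> \<in> carrier_vec n" and U: "\<And>i. i \<le> M \<Longrightarrow> U i \<in> carrier_vec n"
    and f: "f \<in> carrier_vec 2"
  shows "\<phi> \<bullet> (mass *\<^sub>v semidiscrete_rhs M U f k) =
     - (1/3) * (chaos_form M k (\<lambda>i j. \<phi> \<bullet> (mass *\<^sub>v (deriv *\<^sub>v (mult (U i) *\<^sub>v U j))))
                + chaos_form M k (\<lambda>i j. (mult (U j) *\<^sub>v \<phi>) \<bullet> (mass *\<^sub>v (deriv *\<^sub>v U i))))
     - ((restr *\<^sub>v \<phi>) $ 1 * (f $ 1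
          - (1/3) * chaos_form M k (\<lambda>i j. (restr *\<^sub>v (mult (U i) *\<^sub>v U j)) $ 1)
          - (1/6) * chaos_form M k (\<lambda>i j. (restr *\<^sub>v U i) $ 1 * (restr *\<^sub>v U j) $ 1))
        - (restr *\<^sub>v \<phi>) $ 0 * (f $ 0
          - (1/3) * chaos_form M k (\<lambda>i j. (restr *\<^sub>v (mult (U i) *\<^sub>v U j)) $ 0)
          - (1/6) * chaos_form M k (\<lambda>i j. (restr *\<^sub>v U i) $ 0 * (restr *\<^sub>v U j) $ 0)))"
proof -
  let ?adj = "\<lambda>i j. (mass_inv * transpose_mat (mult (U j)) * mass) *\<^sub>v (deriv *\<^sub>v U i)"
  define w where "w = (\<lambda>i j. deriv *\<^sub>v (mult (U i) *\<^sub>v U j) + ?adj i j)"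
  define z where "z = (\<lambda>i j. (1/3) \<cdot>\<^sub>v (restr *\<^sub>v (mult (U i) *\<^sub>v U j))
            + (1/6) \<cdot>\<^sub>v hadamard (restr *\<^sub>v U i) (restr *\<^sub>v U j))"
  define g where "g = f - chaos_sum M 2 k z"
  define X where "X = chaos_sum M n k w"
  define Y where "Y = transpose_mat restr *\<^sub>v (bdry_mat *\<^sub>v g)"
  have adj_c: "?adj i j \<in> carrier_vec n" if "i \<le> M" "j \<le> M" for i j
    by (rule mult_mat_vec_carrier[of _ n n]) (use mass_inv_carrier mass_carrier that U in auto)
  have w_c: "w i j \<in> carrier_vec n" if "i \<le> M" "j \<le> M" for i j
    using adj_c that U by (simp add: w_def)
  have X_c: "X \<in> carrier_vec n" by (simp add: X_def)
  have g_c: "g \<in> carrier_vec 2" using f by (simp add: g_def)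
  have Bg_c: "bdry_mat *\<^sub>v g \<in> carrier_vec 2"
    using bdry_mat_carrier g_c by (rule mult_mat_vec_carrier)
  have Y_c: "Y \<in> carrier_vec n"
    unfolding Y_def using restr_carrier Bg_c by (intro mult_mat_vec_carrier[of _ n 2]) auto
  have iY_c: "mass_inv *\<^sub>v Y \<in> carrier_vec n"
    using mass_inv_carrier Y_c by (rule mult_mat_vec_carrier)
  have rhs: "semidiscrete_rhs M U f k = (- (1/3)) \<cdot>\<^sub>v X - mass_inv *\<^sub>v Y"
    by (simp add: semidiscrete_rhs_def X_def Y_def g_def w_def z_def)
  have "mass *\<^sub>v (mass_inv *\<^sub>v Y) = Y"
    using assoc_mult_mat_vec[OF mass_carrier mass_inv_carrier Y_c] Y_c by (simp add: mass_inverse)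
  hence "mass *\<^sub>v semidiscrete_rhs M U f k = (- (1/3)) \<cdot>\<^sub>v (mass *\<^sub>v X) - Y"
    unfolding rhs using X_c iY_c
    by (subst mult_minus_distrib_mat_vec[OF mass_carrier]) (auto simp: mult_mat_vec[OF mass_carrier])
  hence split: "\<phi> \<bullet> (mass *\<^sub>v semidiscrete_rhs M U f k) = - (1/3) * (\<phi> \<bullet> (mass *\<^sub>v X)) - \<phi> \<bullet> Y"
    using X_c Y_c \<phi> by (simp add: scalar_prod_minus_distrib[of _ n] scalar_prod_smult_distrib[of _ n]
        del: scalar_prod_smult_right)
  have "\<phi> \<bullet> (mass *\<^sub>v X) = (mass *\<^sub>v \<phi>) \<bullet> X"
    using mass_form_symmetric[OF \<phi> X_c] X_c \<phi> by (simp add: comm_scalar_prod[of X n])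
  also have "\<dots> = chaos_form M k (\<lambda>i j. (mass *\<^sub>v \<phi>) \<bullet> w i j)"
    unfolding X_def using w_c by (rule scalar_prod_chaos_sum)
  also have "\<dots> = chaos_form M k (\<lambda>i j. \<phi> \<bullet> (mass *\<^sub>v (deriv *\<^sub>v (mult (U i) *\<^sub>v U j)))
                + (mult (U j) *\<^sub>v \<phi>) \<bullet> (mass *\<^sub>v (deriv *\<^sub>v U i)))"
  proof (rule chaos_form_cong)
    fix i j assume ij: "i \<le> M" "j \<le> M"
    have "(mass *\<^sub>v \<phi>) \<bullet> w i j = \<phi> \<bullet> (mass *\<^sub>v w i j)"
      using mass_form_symmetric[OF \<phi> w_c[OF ij]] w_c[OF ij] \<phi> by (simp add: comm_scalar_prod[of "w i j" n])
    also have "mass *\<^sub>v w i j = mass *\<^sub>v (deriv *\<^sub>v (mult (U i) *\<^sub>v U j))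
        + transpose_mat (mult (U j)) *\<^sub>v (mass *\<^sub>v (deriv *\<^sub>v U i))"
      unfolding w_def using ij U adj_c
      by (subst mult_add_distrib_mat_vec[OF mass_carrier]) (auto simp: mass_mult_adjoint)
    also have "\<phi> \<bullet> \<dots> = \<phi> \<bullet> (mass *\<^sub>v (deriv *\<^sub>v (mult (U i) *\<^sub>v U j)))
        + \<phi> \<bullet> (transpose_mat (mult (U j)) *\<^sub>v (mass *\<^sub>v (deriv *\<^sub>v U i)))"
      using ij U \<phi> mult_carrier mass_carrier deriv_carrier by (intro scalar_prod_add_distrib[of _ n] mult_mat_vec_carrier[of _ n n]) auto
    also have "\<phi> \<bullet> (transpose_mat (mult (U j)) *\<^sub>v (mass *\<^sub>v (deriv *\<^sub>v U i)))
        = (mult (U j) *\<^sub>v \<phi>) \<bullet> (mass *\<^sub>v (deriv *\<^sub>v U i))"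
      using ij U \<phi> mult_carrier by (intro scalar_prod_transpose[where m = n]) auto
    finally show "(mass *\<^sub>v \<phi>) \<bullet> w i j = \<phi> \<bullet> (mass *\<^sub>v (deriv *\<^sub>v (mult (U i) *\<^sub>v U j)))
                + (mult (U j) *\<^sub>v \<phi>) \<bullet> (mass *\<^sub>v (deriv *\<^sub>v U i))" .
  qed
  finally have vol: "\<phi> \<bullet> (mass *\<^sub>v X)
      = chaos_form M k (\<lambda>i j. \<phi> \<bullet> (mass *\<^sub>v (deriv *\<^sub>v (mult (U i) *\<^sub>v U j))))
      + chaos_form M k (\<lambda>i j. (mult (U j) *\<^sub>v \<phi>) \<bullet> (mass *\<^sub>v (deriv *\<^sub>v U i)))"
    by (simp add: chaos_form_add)
  have g: "g $ l = f $ l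
      - (1/3) * chaos_form M k (\<lambda>i j. (restr *\<^sub>v (mult (U i) *\<^sub>v U j)) $ l)
      - (1/6) * chaos_form M k (\<lambda>i j. (restr *\<^sub>v U i) $ l * (restr *\<^sub>v U j) $ l)" if "l < 2" for l
  proof -
    have "chaos_form M k (\<lambda>i j. z i j $ l) = chaos_form M k (\<lambda>i j.
        (1/3) * (restr *\<^sub>v (mult (U i) *\<^sub>v U j)) $ l + (1/6) * ((restr *\<^sub>v U i) $ l * (restr *\<^sub>v U j) $ l))"
    proof (rule chaos_form_cong)
      fix i j
      show "z i j $ l = (1/3) * (restr *\<^sub>v (mult (U i) *\<^sub>v U j)) $ l
          + (1/6) * ((restr *\<^sub>v U i) $ l * (restr *\<^sub>v U j) $ l)"
        using that restr_carrier by (simp add: z_def hadamard_def del: index_mult_mat_vec)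
    qed
    also have "\<dots> = (1/3) * chaos_form M k (\<lambda>i j. (restr *\<^sub>v (mult (U i) *\<^sub>v U j)) $ l)
        + (1/6) * chaos_form M k (\<lambda>i j. (restr *\<^sub>v U i) $ l * (restr *\<^sub>v U j) $ l)"
      by (simp only: chaos_form_add chaos_form_scale)
    finally show ?thesis using that f
      by (simp add: g_def chaos_sum_index carrier_vecD[OF chaos_sum_carrier] del: index_mult_mat_vec)
  qed
  have "\<phi> \<bullet> Y = (restr *\<^sub>v \<phi>) $ 1 * g $ 1 - (restr *\<^sub>v \<phi>) $ 0 * g $ 0"
    unfolding Y_def using scalar_prod_transpose[OF restr_carrier \<phi> Bg_c] scalar_prod_bdry_mat[OF g_c] by simp
  thus ?thesis unfolding split vol by (simp add: g)
qed

text \<open>Testing with $\varphi = 1$. The first volume term is the derivative of the product and integrates to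
boundary values of $u_i u_j$. In the second one $u_j^T M D u_i$ is symmetrised in $i, j$, which is allowed
by the symmetry of the triple products, and becomes half of the boundary values $u_i \cdot u_j$.
With the factor $1/3$ these are exactly the two correction terms, so only the numerical flux remains.\<close>

lemma element_conservation:
  assumes U: "\<And>i. i \<le> M \<Longrightarrow> U i \<in> carrier_vec n" and f: "f \<in> carrier_vec 2"
  shows "one \<bullet> (mass *\<^sub>v semidiscrete_rhs M U f k) = f $ 0 - f $ 1"
proof -
  let ?G = "\<lambda>i j. U j \<bullet> (mass *\<^sub>v (deriv *\<^sub>v U i))"
  let ?r = "\<lambda>i l. (restr *\<^sub>v U i) $ l"
  let ?q = "\<lambda>i j l. (restr *\<^sub>v (mult (U i) *\<^sub>v U j)) $ l"
  have one_deriv: "one \<bullet> (mass *\<^sub>v (deriv *\<^sub>v v)) = (restr *\<^sub>v v) $ 1 - (restr *\<^sub>v v) $ 0"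
    if "v \<in> carrier_vec n" for v
  proof -
    have "mass *\<^sub>v 0\<^sub>v n = 0\<^sub>v n" using mass_carrier by auto
    thus ?thesis using sbp[OF one_carrier that] that by (simp add: deriv_one restr_one[simplified] del: index_mult_mat_vec)
  qed
  have "chaos_form M k (\<lambda>i j. one \<bullet> (mass *\<^sub>v (deriv *\<^sub>v (mult (U i) *\<^sub>v U j))))
          = chaos_form M k (\<lambda>i j. ?q i j 1 - ?q i j 0)"
    using U by (intro chaos_form_cong) (simp add: one_deriv del: index_mult_mat_vec)
  hence A: "chaos_form M k (\<lambda>i j. one \<bullet> (mass *\<^sub>v (deriv *\<^sub>v (mult (U i) *\<^sub>v U j))))
          = chaos_form M k (\<lambda>i j. ?q i j 1) - chaos_form M k (\<lambda>i j. ?q i j 0)"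
    by (simp only: chaos_form_diff)
  have B: "chaos_form M k (\<lambda>i j. (mult (U j) *\<^sub>v one) \<bullet> (mass *\<^sub>v (deriv *\<^sub>v U i))) = chaos_form M k ?G"
    using U by (intro chaos_form_cong) (simp add: mult_one)
  have "chaos_form M k ?G + chaos_form M k (\<lambda>i j. ?G j i)
          = chaos_form M k (\<lambda>i j. ?r i 1 * ?r j 1 - ?r i 0 * ?r j 0)"
    unfolding chaos_form_add[symmetric]
  proof (rule chaos_form_cong)
    fix i j assume "i \<le> M" "j \<le> M"
    thus "?G i j + ?G j i = ?r i 1 * ?r j 1 - ?r i 0 * ?r j 0" using sbp[OF U U, of i j] by linarith
  qed
  hence C: "2 * chaos_form M k ?G
      = chaos_form M k (\<lambda>i j. ?r i 1 * ?r j 1) - chaos_form M k (\<lambda>i j. ?r i 0 * ?r j 0)"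
    unfolding chaos_form_swap[of M k ?G] chaos_form_diff by linarith
  have "one \<bullet> (mass *\<^sub>v semidiscrete_rhs M U f k) =
     - (1/3) * (chaos_form M k (\<lambda>i j. ?q i j 1) - chaos_form M k (\<lambda>i j. ?q i j 0) + chaos_form M k ?G)
     - (1 * (f $ 1 - (1/3) * chaos_form M k (\<lambda>i j. ?q i j 1)
          - (1/6) * chaos_form M k (\<lambda>i j. ?r i 1 * ?r j 1))
        - 1 * (f $ 0 - (1/3) * chaos_form M k (\<lambda>i j. ?q i j 0)
          - (1/6) * chaos_form M k (\<lambda>i j. ?r i 0 * ?r j 0)))"
    using U f by (simp only: rhs_tested[OF one_carrier] restr_one A B)
  thus ?thesis using C by argo
qed

text \<open>Testing with $\varphi = u_k$ and summing over $k$. After exchanging $i$ and $k$ the second volume term is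
$(u_i u_j)^T M D u_k$, which pairs with the first one by summation by parts into boundary values of
$u_k$ times those of the discrete product. These cancel the correction term with factor $1/3$. The
correction with factor $1/6$ is the flux potential of the boundary values.\<close>

lemma element_entropy_rate:
  assumes U: "\<And>i. i \<le> M \<Longrightarrow> U i \<in> carrier_vec n" and f: "\<And>k. k \<le> M \<Longrightarrow> f k \<in> carrier_vec 2"
  shows "(\<Sum>k\<le>M. U k \<bullet> (mass *\<^sub>v semidiscrete_rhs M U (f k) k)) =
      flux_potential M (vec (M + 1) (\<lambda>k. (restr *\<^sub>v U k) $ 1))
      - flux_potential M (vec (M + 1) (\<lambda>k. (restr *\<^sub>v U k) $ 0))
      - ((\<Sum>k\<le>M. (restr *\<^sub>v U k) $ 1 * f k $ 1) - (\<Sum>k\<le>M. (restr *\<^sub>v U k) $ 0 * f k $ 0))"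
proof -
  let ?r = "\<lambda>i l. (restr *\<^sub>v U i) $ l"
  let ?q = "\<lambda>i j l. (restr *\<^sub>v (mult (U i) *\<^sub>v U j)) $ l"
  let ?D1 = "\<lambda>k i j. U k \<bullet> (mass *\<^sub>v (deriv *\<^sub>v (mult (U i) *\<^sub>v U j)))"
  let ?D2 = "\<lambda>i j k. (mult (U j) *\<^sub>v U k) \<bullet> (mass *\<^sub>v (deriv *\<^sub>v U i))"
  have "(\<Sum>k\<le>M. chaos_form M k (?D1 k)) + (\<Sum>k\<le>M. chaos_form M k (\<lambda>i j. ?D2 i j k))
      = (\<Sum>k\<le>M. chaos_form M k (?D1 k)) + (\<Sum>k\<le>M. chaos_form M k (\<lambda>i j. ?D2 k j i))"
    using chaos_form_total_swap[of M ?D2] by simp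
  also have "\<dots> = (\<Sum>k\<le>M. chaos_form M k (\<lambda>i j. ?D1 k i j + ?D2 k j i))"
    by (simp add: sum.distrib chaos_form_add)
  also have "\<dots> = (\<Sum>k\<le>M. chaos_form M k (\<lambda>i j. ?r k 1 * ?q i j 1 - ?r k 0 * ?q i j 0))"
  proof (intro sum.cong refl chaos_form_cong)
    fix k i j assume "k \<in> {..M}" "i \<le> M" "j \<le> M"
    thus "?D1 k i j + ?D2 k j i = ?r k 1 * ?q i j 1 - ?r k 0 * ?q i j 0"
      using sbp[of "U k" "mult (U i) *\<^sub>v U j"] U mult_commute[of "U i" "U j"] by simp
  qed
  also have "\<dots> = (\<Sum>k\<le>M. ?r k 1 * chaos_form M k (\<lambda>i j. ?q i j 1)
                            - ?r k 0 * chaos_form M k (\<lambda>i j. ?q i j 0))"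
    by (simp only: chaos_form_diff chaos_form_scale)
  finally have vol: "(\<Sum>k\<le>M. chaos_form M k (?D1 k)) + (\<Sum>k\<le>M. chaos_form M k (\<lambda>i j. ?D2 i j k))
      = (\<Sum>k\<le>M. ?r k 1 * chaos_form M k (\<lambda>i j. ?q i j 1))
        - (\<Sum>k\<le>M. ?r k 0 * chaos_form M k (\<lambda>i j. ?q i j 0))"
    by (simp only: sum_subtractf)
  have pot: "flux_potential M (vec (M + 1) (\<lambda>k. ?r k l))
      = (1/6) * (\<Sum>k\<le>M. ?r k l * chaos_form M k (\<lambda>i j. ?r i l * ?r j l))" for l
  proof -
    have "(\<Sum>k\<le>M. ?r k l * chaos_form M k (\<lambda>i j. ?r i l * ?r j l))
        = (\<Sum>i\<le>M. \<Sum>j\<le>M. \<Sum>k\<le>M. triple_E i j k * (?r k l * (?r i l * ?r j l)))"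
      using chaos_form_total[of M "\<lambda>i j k. ?r k l * (?r i l * ?r j l)"]
      by (simp only: chaos_form_scale)
    also have "\<dots> = (\<Sum>i\<le>M. \<Sum>j\<le>M. \<Sum>k\<le>M. triple_E i j k * vec (M + 1) (\<lambda>k. ?r k l) $ i
        * vec (M + 1) (\<lambda>k. ?r k l) $ j * vec (M + 1) (\<lambda>k. ?r k l) $ k)"
      by (intro sum.cong refl) (simp add: ac_simps del: index_mult_mat_vec)
    finally show ?thesis by (simp only: flux_potential_def)
  qed
  have "(\<Sum>k\<le>M. U k \<bullet> (mass *\<^sub>v semidiscrete_rhs M U (f k) k)) = (\<Sum>k\<le>M.
     - (1/3) * (chaos_form M k (?D1 k) + chaos_form M k (\<lambda>i j. ?D2 i j k))
     - (?r k 1 * (f k $ 1 - (1/3) * chaos_form M k (\<lambda>i j. ?q i j 1)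
          - (1/6) * chaos_form M k (\<lambda>i j. ?r i 1 * ?r j 1))
        - ?r k 0 * (f k $ 0 - (1/3) * chaos_form M k (\<lambda>i j. ?q i j 0)
          - (1/6) * chaos_form M k (\<lambda>i j. ?r i 0 * ?r j 0))))"
    by (intro sum.cong refl rhs_tested U f) auto
  also have "\<dots> = - (1/3) * ((\<Sum>k\<le>M. chaos_form M k (?D1 k)) + (\<Sum>k\<le>M. chaos_form M k (\<lambda>i j. ?D2 i j k)))
      - (\<Sum>k\<le>M. ?r k 1 * f k $ 1) + (\<Sum>k\<le>M. ?r k 0 * f k $ 0)
      + (1/3) * ((\<Sum>k\<le>M. ?r k 1 * chaos_form M k (\<lambda>i j. ?q i j 1))
        - (\<Sum>k\<le>M. ?r k 0 * chaos_form M k (\<lambda>i j. ?q i j 0)))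
      + (1/6) * (\<Sum>k\<le>M. ?r k 1 * chaos_form M k (\<lambda>i j. ?r i 1 * ?r j 1))
      - (1/6) * (\<Sum>k\<le>M. ?r k 0 * chaos_form M k (\<lambda>i j. ?r i 0 * ?r j 0))"
    unfolding sum_distrib_left sum.distrib[symmetric] sum_subtractf[symmetric]
    by (intro sum.cong refl) (simp add: algebra_simps)
  finally show ?thesis unfolding vol pot by simp
qed

end

section \<open>The operators on a mesh element\<close>

lemma smult_mat_mult_vec:
  fixes A :: "real mat"
  assumes "A \<in> carrier_mat m n" "v \<in> carrier_vec n"
  shows "(c \<cdot>\<^sub>m A) *\<^sub>v v = c \<cdot>\<^sub>v (A *\<^sub>v v)"
  using assms by (intro eq_vecI) auto

lemma ref_mass_carrier: "ref_mass b p \<in> carrier_mat (p + 1) (p + 1)"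
  by (simp add: ref_mass_diagonal)

lemma ref_deriv_carrier: "ref_deriv b p \<in> carrier_mat (p + 1) (p + 1)"
  by (simp add: ref_deriv_def matrix_of_def)

lemma restr_mat_carrier: "restr_mat b p \<in> carrier_mat 2 (p + 1)"
  by (simp add: restr_mat_def)

lemma mult_mat_carrier: "mult_mat b p v \<in> carrier_mat (p + 1) (p + 1)"
  by (cases b) (simp_all add: nodal_mult_def matrix_of_def)

lemma elem_mass_carrier: "elem_mass b p x e \<in> carrier_mat (p + 1) (p + 1)"
  using ref_mass_carrier by (simp add: elem_mass_def)

lemma elem_deriv_carrier: "elem_deriv b p x e \<in> carrier_mat (p + 1) (p + 1)"
  using ref_deriv_carrier by (simp add: elem_deriv_def)

text \<open>The mass matrix is diagonal with positive entries in all three bases, hence invertible.\<close>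

lemma elem_mass_inverse:
  assumes "admissible b p" "elem_len x e > 0"
  shows "elem_mass_inv b p x e \<in> carrier_mat (p + 1) (p + 1)"
    "elem_mass b p x e * elem_mass_inv b p x e = 1\<^sub>m (p + 1)"
proof -
  let ?d = "\<lambda>i. elem_len x e / 2 * weight b p i"
  let ?A = "mat (p + 1) (p + 1) (\<lambda>(i, j). if i = j then ?d i else 0)"
  let ?B = "mat (p + 1) (p + 1) (\<lambda>(i, j). if i = j then 1 / ?d i else 0)"
  have A: "elem_mass b p x e = ?A"
    by (rule eq_matI) (auto simp: elem_mass_def ref_mass_diagonal)
  have prod: "mat (p + 1) (p + 1) (\<lambda>(i, j). if i = j then f i else 0)
      * mat (p + 1) (p + 1) (\<lambda>(i, j). if i = j then g i else 0) = 1\<^sub>m (p + 1)"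
    if fg: "\<And>i. i \<le> p \<Longrightarrow> f i * g i = 1" for f g :: "nat \<Rightarrow> real"
  proof (rule eq_matI)
    fix i j assume "i < dim_row (1\<^sub>m (p + 1))" "j < dim_col (1\<^sub>m (p + 1))"
    hence ij: "i < p + 1" "j < p + 1" by auto
    have "(\<Sum>l = 0..<p + 1. (if i = l then f i else 0) * (if l = j then g l else 0))
        = (\<Sum>l = 0..<p + 1. if l = i then f i * (if i = j then g i else 0) else 0)"
      by (intro sum.cong) auto
    also have "\<dots> = (if i = j then 1 else 0)" using ij fg[of i] by auto
    finally show "(mat (p + 1) (p + 1) (\<lambda>(i, j). if i = j then f i else 0)
        * mat (p + 1) (p + 1) (\<lambda>(i, j). if i = j then g i else 0)) $$ (i, j) = 1\<^sub>m (p + 1) $$ (i, j)"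
      using ij by (simp add: scalar_prod_def del: sum.op_ivl_Suc)
  qed auto
  have nz: "?d i \<noteq> 0" if "i \<le> p" for i
    using weight_pos[OF assms(1) that] assms(2) by simp
  have "?A * ?B = 1\<^sub>m (p + 1)" "?B * ?A = 1\<^sub>m (p + 1)"
    using nz by (intro prod; simp)+
  hence "?A \<in> Units (ring_mat TYPE(real) (p + 1) ())"
    by (auto simp: Units_def ring_mat_simps intro!: bexI[of _ ?B])
  hence "mat_inverse ?A \<noteq> None"
    using mat_inverse(1)[of ?A "p + 1" "()"] by auto
  then obtain C where C: "mat_inverse ?A = Some C" by auto
  hence "elem_mass_inv b p x e = C" by (simp add: elem_mass_inv_def A)
  thus "elem_mass_inv b p x e \<in> carrier_mat (p + 1) (p + 1)"
    "elem_mass b p x e * elem_mass_inv b p x e = 1\<^sub>m (p + 1)"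
    using mat_inverse(2)[OF _ C, of "p + 1"] unfolding A by auto
qed

text \<open>The scaling factors of the mass and derivative matrices cancel.\<close>

lemma elem_mass_deriv_form:
  assumes "admissible b p" "elem_len x e > 0" "v \<in> carrier_vec (p + 1)" "w \<in> carrier_vec (p + 1)"
  shows "v \<bullet> (elem_mass b p x e *\<^sub>v (elem_deriv b p x e *\<^sub>v w))
           = pint (poly_of_coeffs b p v * pderiv (poly_of_coeffs b p w))"
proof -
  have Dw: "ref_deriv b p *\<^sub>v w \<in> carrier_vec (p + 1)"
    using ref_deriv_carrier assms(4) by (rule mult_mat_vec_carrier)
  have "elem_mass b p x e *\<^sub>v (elem_deriv b p x e *\<^sub>v w)
      = (elem_len x e / 2) \<cdot>\<^sub>v (ref_mass b p *\<^sub>v ((2 / elem_len x e) \<cdot>\<^sub>v (ref_deriv b p *\<^sub>v w)))"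
    unfolding elem_mass_def elem_deriv_def using Dw
    by (subst smult_mat_mult_vec[OF ref_deriv_carrier assms(4)],
        subst smult_mat_mult_vec[OF ref_mass_carrier]) auto
  also have "\<dots> = ref_mass b p *\<^sub>v (ref_deriv b p *\<^sub>v w)"
    using assms(2) by (simp add: mult_mat_vec[OF ref_mass_carrier Dw] smult_smult_assoc)
  finally show ?thesis using mass_deriv_form[OF assms(1,3,4)] by simp
qed

lemma one_coeffs_represents_1:
  assumes "admissible b p"
  shows "one_coeffs b p = coords b p 1" "poly_of_coeffs b p (one_coeffs b p) = 1"
  using assms by (simp_all add: one_coeffs_def coeff_vec_eq_coords poly_of_coeffs_coords)

lemma element_sbp_operators:
  assumes "admissible b p" "elem_len x e > 0"
  shows "sbp_operators (p + 1) (elem_mass b p x e) (elem_mass_inv b p x e) (elem_deriv b p x e)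
           (restr_mat b p) (mult_mat b p) (one_coeffs b p)"
proof
  let ?P = "poly_of_coeffs b p"
  show "transpose_mat (elem_mass b p x e) = elem_mass b p x e"
    by (rule eq_matI) (auto simp: elem_mass_def ref_mass_diagonal)
  show one: "one_coeffs b p \<in> carrier_vec (p + 1)"
    using one_coeffs_represents_1[OF assms(1)] by simp
  show "v \<bullet> (elem_mass b p x e *\<^sub>v (elem_deriv b p x e *\<^sub>v w))
        + w \<bullet> (elem_mass b p x e *\<^sub>v (elem_deriv b p x e *\<^sub>v v))
      = (restr_mat b p *\<^sub>v v) $ 1 * (restr_mat b p *\<^sub>v w) $ 1
        - (restr_mat b p *\<^sub>v v) $ 0 * (restr_mat b p *\<^sub>v w) $ 0"
    if "v \<in> carrier_vec (p + 1)" "w \<in> carrier_vec (p + 1)" for v w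
    using pint_by_parts[of "?P v" "?P w"]
    unfolding elem_mass_deriv_form[OF assms that] elem_mass_deriv_form[OF assms that(2,1)]
      restr_mat_mult_vec[OF that(1)] restr_mat_mult_vec[OF that(2)]
    by (simp add: mult.commute)
  have "ref_deriv b p *\<^sub>v one_coeffs b p = 0\<^sub>v (p + 1)"
  proof (rule eq_vecI)
    fix i assume "i < dim_vec (0\<^sub>v (p + 1) :: real vec)"
    hence "i \<le> p" by simp
    moreover have "coord b p i 0 = 0" using coord_sum[of b p i "\<lambda>_. 0" "\<lambda>_. 0" "{}"] by simp
    ultimately show "(ref_deriv b p *\<^sub>v one_coeffs b p) $ i = 0\<^sub>v (p + 1) $ i"
      using ref_deriv_mult_vec[OF assms(1) one] one_coeffs_represents_1(2)[OF assms(1)]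
      by (simp add: pderiv_1 del: index_mult_mat_vec)
  qed (use ref_deriv_carrier[of b p] in auto)
  thus "elem_deriv b p x e *\<^sub>v one_coeffs b p = 0\<^sub>v (p + 1)"
    unfolding elem_deriv_def smult_mat_mult_vec[OF ref_deriv_carrier one] by auto
  show "(restr_mat b p *\<^sub>v one_coeffs b p) $ 0 = 1" "(restr_mat b p *\<^sub>v one_coeffs b p) $ 1 = 1"
    unfolding restr_mat_mult_vec[OF one] one_coeffs_represents_1(2)[OF assms(1)] by simp_all
  show "mult_mat b p v *\<^sub>v w = mult_mat b p w *\<^sub>v v"
    if "v \<in> carrier_vec (p + 1)" "w \<in> carrier_vec (p + 1)" for v w
    using disc_prod_eq_coords[OF assms(1) that] disc_prod_eq_coords[OF assms(1) that(2,1)]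
    by (simp add: disc_prod_def mult.commute)
  show "mult_mat b p v *\<^sub>v one_coeffs b p = v" if "v \<in> carrier_vec (p + 1)" for v
    using disc_prod_eq_coords[OF assms(1) that one] coords_poly_of_coeffs[OF assms(1) that]
    by (simp add: disc_prod_def one_coeffs_represents_1(2)[OF assms(1)])
qed (use assms elem_mass_inverse elem_mass_carrier elem_deriv_carrier restr_mat_carrier mult_mat_carrier in auto)

lemma scheme_rhs_eq_semidiscrete_rhs:
  assumes "admissible b p" "elem_len x e > 0"
  shows "scheme_rhs st b p M x fnum U e k =
    sbp_operators.semidiscrete_rhs (p + 1) (elem_mass b p x e) (elem_mass_inv b p x e)
      (elem_deriv b p x e) (restr_mat b p) (mult_mat b p) M (U e)
      (vec 2 (\<lambda>r. if r = 0 then flux_left st b p M fnum U e k else flux_right st b p M fnum U e k)) k"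
  unfolding sbp_operators.semidiscrete_rhs_def[OF element_sbp_operators[OF assms]]
    scheme_rhs_def Let_def mult_adj_def disc_prod_def ..

lemma scheme_conservation:
  assumes "admissible b p" "elem_len x e > 0" "\<And>k. k \<le> M \<Longrightarrow> U e k \<in> carrier_vec (p + 1)"
  shows "one_coeffs b p \<bullet> (elem_mass b p x e *\<^sub>v scheme_rhs st b p M x fnum U e k)
           = flux_left st b p M fnum U e k - flux_right st b p M fnum U e k"
proof -
  interpret sbp_operators "p + 1" "elem_mass b p x e" "elem_mass_inv b p x e" "elem_deriv b p x e"
    "restr_mat b p" "mult_mat b p" "one_coeffs b p"
    by (rule element_sbp_operators[OF assms(1,2)])
  show ?thesis
    unfolding scheme_rhs_eq_semidiscrete_rhs[OF assms(1,2)]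
    by (subst element_conservation[OF assms(3)]) auto
qed

text \<open>The entropy rate of an element is a contribution of its left end minus one of its right end. Each has
the form $u \cdot f^{num} - \psi(u)$ with the boundary value $u$ of that end, so the two contributions
belonging to one interface can be compared by Tadmor's condition.\<close>

lemma scheme_entropy_rate:
  assumes "admissible b p" "elem_len x e > 0" "\<And>k. k \<le> M \<Longrightarrow> U e k \<in> carrier_vec (p + 1)"
  shows "(\<Sum>k\<le>M. U e k \<bullet> (elem_mass b p x e *\<^sub>v scheme_rhs st b p M x fnum U e k))
     = ((\<Sum>k\<le>M. left_state b p M U e $ k * flux_left st b p M fnum U e k)
         - flux_potential M (left_state b p M U e))
       - ((\<Sum>k\<le>M. right_state b p M U e $ k * flux_right st b p M fnum U e k)
         - flux_potential M (right_state b p M U e))"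
proof -
  interpret sbp_operators "p + 1" "elem_mass b p x e" "elem_mass_inv b p x e" "elem_deriv b p x e"
    "restr_mat b p" "mult_mat b p" "one_coeffs b p"
    by (rule element_sbp_operators[OF assms(1,2)])
  show ?thesis
    unfolding scheme_rhs_eq_semidiscrete_rhs[OF assms(1,2)]
    by (subst element_entropy_rate[OF assms(3)])
       (auto simp: left_state_def right_state_def simp del: index_mult_mat_vec)
qed

lemma scheme_rhs_carrier:
  assumes "admissible b p" "elem_len x e > 0"
  shows "scheme_rhs st b p M x fnum U e k \<in> carrier_vec (p + 1)"
  unfolding scheme_rhs_def Let_def
  by (rule carrier_vecI) (simp add: carrier_matD(1)[OF elem_mass_inverse(1)[OF assms]])

section \<open>Derivatives of linear and quadratic forms\<close>

lemma bilinear_form_eq_sum: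
  fixes A :: "real mat"
  assumes "A \<in> carrier_mat n n" "w \<in> carrier_vec n"
  shows "v \<bullet> (A *\<^sub>v w) = (\<Sum>i<n. \<Sum>j<n. v $ i * A $$ (i, j) * w $ j)"
  using assms by (simp add: scalar_prod_def atLeast0LessThan sum_distrib_left mult.assoc)

lemma has_real_derivative_linear_form:
  fixes A :: "real mat"
  assumes A: "A \<in> carrier_mat n n" and t: "t \<in> T"
    and y: "\<And>s. s \<in> T \<Longrightarrow> y s \<in> carrier_vec n" and r: "r \<in> carrier_vec n"
    and deriv: "\<And>l. l < n \<Longrightarrow> ((\<lambda>s. y s $ l) has_real_derivative r $ l) (at t within T)"
  shows "((\<lambda>s. v \<bullet> (A *\<^sub>v y s)) has_real_derivative v \<bullet> (A *\<^sub>v r)) (at t within T)"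
proof (rule has_field_derivative_transform_within[where d = 1])
  show "((\<lambda>s. \<Sum>i<n. \<Sum>j<n. v $ i * A $$ (i, j) * y s $ j) has_real_derivative v \<bullet> (A *\<^sub>v r)) (at t within T)"
    unfolding bilinear_form_eq_sum[OF A r]
    by (intro DERIV_sum DERIV_cmult deriv) auto
qed (use A y t in \<open>auto simp: bilinear_form_eq_sum\<close>)

lemma has_real_derivative_quadratic_form:
  fixes A :: "real mat"
  assumes A: "A \<in> carrier_mat n n" and sym: "transpose_mat A = A" and t: "t \<in> T"
    and y: "\<And>s. s \<in> T \<Longrightarrow> y s \<in> carrier_vec n" and r: "r \<in> carrier_vec n"
    and deriv: "\<And>l. l < n \<Longrightarrow> ((\<lambda>s. y s $ l) has_real_derivative r $ l) (at t within T)"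
  shows "((\<lambda>s. y s \<bullet> (A *\<^sub>v y s)) has_real_derivative 2 * (y t \<bullet> (A *\<^sub>v r))) (at t within T)"
proof (rule has_field_derivative_transform_within[where d = 1])
  have "A $$ (i, j) = A $$ (j, i)" if "i < n" "j < n" for i j
    using A that index_transpose_mat(1)[of j A i] by (simp add: sym)
  hence "r \<bullet> (A *\<^sub>v y t) = (\<Sum>i<n. \<Sum>j<n. y t $ j * A $$ (j, i) * r $ i)"
    using A y[OF t] by (simp add: bilinear_form_eq_sum ac_simps)
  also have "\<dots> = y t \<bullet> (A *\<^sub>v r)"
    unfolding bilinear_form_eq_sum[OF A r] by (rule sum.swap)
  finally have "2 * (y t \<bullet> (A *\<^sub>v r)) = r \<bullet> (A *\<^sub>v y t) + y t \<bullet> (A *\<^sub>v r)" by simp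
  also have "\<dots> = (\<Sum>i<n. \<Sum>j<n. r $ i * A $$ (i, j) * y t $ j + y t $ i * A $$ (i, j) * r $ j)"
    using A y[OF t] r by (simp add: bilinear_form_eq_sum sum.distrib)
  finally have eq: "2 * (y t \<bullet> (A *\<^sub>v r))
      = (\<Sum>i<n. \<Sum>j<n. r $ i * A $$ (i, j) * y t $ j + y t $ i * A $$ (i, j) * r $ j)" .
  show "((\<lambda>s. \<Sum>i<n. \<Sum>j<n. y s $ i * A $$ (i, j) * y s $ j) has_real_derivative
      2 * (y t \<bullet> (A *\<^sub>v r))) (at t within T)"
    unfolding eq
    by (intro DERIV_sum) (auto intro!: derivative_eq_intros deriv)
qed (use A y t in \<open>auto simp: bilinear_form_eq_sum\<close>)

section \<open>Sums over the elements of the mesh\<close>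

lemma neighbours_inverse:
  assumes "valid_mesh st x" "e \<in> elements st"
  shows "left_nb st e \<in> elements st" "right_nb st e \<in> elements st"
    "right_nb st (left_nb st e) = e" "left_nb st (right_nb st e) = e"
  using assms by (cases st; auto simp: valid_mesh_def)+

lemma left_nb_bij: "valid_mesh st x \<Longrightarrow> bij_betw (left_nb st) (elements st) (elements st)"
  by (rule bij_betw_byWitness[where f' = "right_nb st"]) (auto simp: neighbours_inverse)

lemma summable_on_if_zero_outside:
  fixes f :: "'a \<Rightarrow> real"
  assumes "finite A" "\<And>e. e \<in> E \<Longrightarrow> e \<notin> A \<Longrightarrow> f e = 0"
  shows "f summable_on E"
  using assms by (intro finite_nonzero_values_imp_summable_on finite_subset[OF _ assms(1)]) auto

lemma infsum_diff_real:
  fixes f g :: "'a \<Rightarrow> real"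
  assumes "f summable_on E" "g summable_on E"
  shows "(\<Sum>\<^sub>\<infinity>e\<in>E. f e - g e) = infsum f E - infsum g E"
proof -
  have "(\<lambda>e. - g e) summable_on E" using assms(2) by (simp add: summable_on_uminus)
  from infsum_add[OF assms(1) this] show ?thesis by (simp add: infsum_uminus)
qed

text \<open>Taking the left neighbour permutes the elements, in the periodic as well as in the compactly supported
setting. This rearranges a sum over elements into a sum over interfaces.\<close>

lemma infsum_telescope_neighbours:
  fixes L R :: "int \<Rightarrow> real"
  assumes "valid_mesh st x" "L summable_on elements st" "R summable_on elements st"
  shows "(\<Sum>\<^sub>\<infinity>e\<in>elements st. L e - R e) = (\<Sum>\<^sub>\<infinity>e\<in>elements st. L e - R (left_nb st e))"
proof -
  note bij = left_nb_bij[OF assms(1)]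
  have sR: "(\<lambda>e. R (left_nb st e)) summable_on elements st"
    using summable_on_reindex_bij_betw[OF bij, of R] assms(3) by simp
  have "(\<Sum>\<^sub>\<infinity>e\<in>elements st. L e - R e) = infsum L (elements st) - infsum R (elements st)"
    by (rule infsum_diff_real[OF assms(2,3)])
  also have "infsum R (elements st) = (\<Sum>\<^sub>\<infinity>e\<in>elements st. R (left_nb st e))"
    by (rule infsum_reindex_bij_betw[OF bij, symmetric])
  also have "infsum L (elements st) - \<dots> = (\<Sum>\<^sub>\<infinity>e\<in>elements st. L e - R (left_nb st e))"
    by (rule infsum_diff_real[OF assms(2) sR, symmetric])
  finally show ?thesis .
qed

text \<open>The sum over all elements is a finite one, but only at times in $T$; so the derivative has to be taken
within $T$.\<close>

lemma has_real_derivative_infsum_zero_outside: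
  fixes f :: "real \<Rightarrow> 'a \<Rightarrow> real"
  assumes "finite A" "A \<subseteq> E" "t \<in> T"
    and zero: "\<And>s e. s \<in> T \<Longrightarrow> e \<in> E - A \<Longrightarrow> f s e = 0"
    and deriv: "\<And>e. e \<in> A \<Longrightarrow> ((\<lambda>s. f s e) has_real_derivative f' e) (at t within T)"
    and zero': "\<And>e. e \<in> E - A \<Longrightarrow> f' e = 0"
  shows "((\<lambda>s. \<Sum>\<^sub>\<infinity>e\<in>E. f s e) has_real_derivative (\<Sum>\<^sub>\<infinity>e\<in>E. f' e)) (at t within T)"
proof -
  have sum: "(\<Sum>\<^sub>\<infinity>e\<in>E. g e) = (\<Sum>e\<in>A. g e)" if "\<And>e. e \<in> E - A \<Longrightarrow> g e = 0" for g :: "'a \<Rightarrow> real"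
    unfolding infsum_finite[OF assms(1), symmetric]
    using that assms(2) by (intro infsum_cong_neutral) auto
  show ?thesis
  proof (rule has_field_derivative_transform_within[where d = 1])
    show "((\<lambda>s. \<Sum>e\<in>A. f s e) has_real_derivative (\<Sum>\<^sub>\<infinity>e\<in>E. f' e)) (at t within T)"
      using sum[of f'] zero' by (auto intro!: DERIV_sum deriv)
    show "(\<Sum>e\<in>A. f s e) = (\<Sum>\<^sub>\<infinity>e\<in>E. f s e)" if "s \<in> T" for s
      using sum[OF zero[OF that]] by simp
  qed (use assms in auto)
qed

section \<open>Conservation and entropy stability\<close>

lemma zero_boundary_states:
  assumes "\<And>k. k \<le> M \<Longrightarrow> U e k = 0\<^sub>v (p + 1)"
  shows "left_state b p M U e = 0\<^sub>v (M + 1)" "right_state b p M U e = 0\<^sub>v (M + 1)"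
  using assms restr_mat_carrier[of b p]
  by (auto intro!: eq_vecI simp: left_state_def right_state_def scalar_prod_def)

lemma infsum_nonpos_real:
  fixes f :: "'a \<Rightarrow> real"
  assumes "\<And>e. e \<in> E \<Longrightarrow> f e \<le> 0"
  shows "infsum f E \<le> 0"
  using infsum_nonneg[of E "\<lambda>e. - f e"] assms by (simp add: infsum_uminus)

lemma flux_potential_zero: "flux_potential M (0\<^sub>v (M + 1)) = 0"
  by (simp add: flux_potential_def)

text \<open>At an interface the states of both sides meet the same flux, and the difference of the two
contributions is $(u(+) - u(-)) \cdot f^{num} - (\psi(u(+)) - \psi(u(-)))$.\<close>

lemma interface_entropy_production_nonpos:
  assumes "valid_mesh st x" "e \<in> elements st" "entropy_stable_flux M fnum"
    and "\<And>um up. um \<in> carrier_vec (M + 1) \<Longrightarrow> up \<in> carrier_vec (M + 1) \<Longrightarrow>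
         fnum um up \<in> carrier_vec (M + 1)"
  shows "((\<Sum>k\<le>M. left_state b p M U e $ k * flux_left st b p M fnum U e k)
           - flux_potential M (left_state b p M U e))
       - ((\<Sum>k\<le>M. right_state b p M U (left_nb st e) $ k * flux_right st b p M fnum U (left_nb st e) k)
           - flux_potential M (right_state b p M U (left_nb st e))) \<le> 0"
proof -
  define up where "up = left_state b p M U e"
  define um where "um = right_state b p M U (left_nb st e)"
  have c: "up \<in> carrier_vec (M + 1)" "um \<in> carrier_vec (M + 1)"
    by (simp_all add: up_def um_def left_state_def right_state_def)
  have F: "flux_left st b p M fnum U e k = fnum um up $ k"
    "flux_right st b p M fnum U (left_nb st e) k = fnum um up $ k" for k
    using neighbours_inverse(3)[OF assms(1,2)]
    by (simp_all add: flux_left_def flux_right_def interface_flux_def up_def um_def)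
  have "(up - um) \<bullet> fnum um up = (\<Sum>k\<le>M. (up $ k - um $ k) * fnum um up $ k)"
    using c assms(4)[OF c(2,1)] by (simp add: scalar_prod_def atLeast0LessThan lessThan_Suc_atMost)
  also have "\<dots> = (\<Sum>k\<le>M. up $ k * fnum um up $ k) - (\<Sum>k\<le>M. um $ k * fnum um up $ k)"
    by (simp add: left_diff_distrib sum_subtractf)
  finally have "(\<Sum>k\<le>M. up $ k * fnum um up $ k) - (\<Sum>k\<le>M. um $ k * fnum um up $ k)
      \<le> flux_potential M up - flux_potential M um"
    using assms(3) c unfolding entropy_stable_flux_def by fastforce
  thus ?thesis unfolding F up_def[symmetric] um_def[symmetric] by simp
qed

theorem theorem3p7:
  fixes M p :: nat
    and b :: basis_kind
    and st :: setting
    and x :: "int \<Rightarrow> real"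
    and fnum :: "real vec \<Rightarrow> real vec \<Rightarrow> real vec"
    and T :: "real set"
    and u :: "real \<Rightarrow> int \<Rightarrow> nat \<Rightarrow> real vec"
  assumes degree_p: "b = Gauss_Lobatto \<Longrightarrow> p \<ge> 1"
    and mesh: "valid_mesh st x"
    and time: "is_interval T" "interior T \<noteq> {}"
    and fnum_carrier:
      "\<And>um up. um \<in> carrier_vec (M + 1) \<Longrightarrow> up \<in> carrier_vec (M + 1) \<Longrightarrow>
         fnum um up \<in> carrier_vec (M + 1)"
    and fnum_stable: "entropy_stable_flux M fnum"
    and u_carrier:
      "\<And>t e k. t \<in> T \<Longrightarrow> e \<in> elements st \<Longrightarrow> k \<le> M \<Longrightarrow> u t e k \<in> carrier_vec (p + 1)"
    and u_support:
      "st = Compact_Support \<Longrightarrow>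
         \<exists>S. finite S \<and> (\<forall>t\<in>T. \<forall>e. e \<notin> S \<longrightarrow> (\<forall>k\<le>M. u t e k = 0\<^sub>v (p + 1)))"
    and scheme:
      "\<And>t e k l. t \<in> T \<Longrightarrow> e \<in> elements st \<Longrightarrow> k \<le> M \<Longrightarrow> l \<le> p \<Longrightarrow>
         ((\<lambda>s. u s e k $ l) has_real_derivative scheme_rhs st b p M x fnum (u t) e k $ l)
           (at t within T)"
  shows
    "(\<forall>t\<in>T. \<forall>e\<in>elements st. \<forall>k\<le>M.
        ((\<lambda>s. one_coeffs b p \<bullet> (elem_mass b p x e *\<^sub>v u s e k)) has_real_derivative
           (flux_left st b p M fnum (u t) e k - flux_right st b p M fnum (u t) e k))
          (at t within T))
     \<and> (\<forall>t\<in>T. \<forall>e\<in>elements st. \<forall>k\<le>M.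
        flux_right st b p M fnum (u t) (left_nb st e) k = flux_left st b p M fnum (u t) e k)
     \<and> (\<forall>k\<le>M. \<exists>c. \<forall>t\<in>T.
        (\<Sum>\<^sub>\<infinity>e\<in>elements st. one_coeffs b p \<bullet> (elem_mass b p x e *\<^sub>v u t e k)) = c)
     \<and> (\<forall>t\<in>T. \<exists>d.
        ((\<lambda>s. \<Sum>\<^sub>\<infinity>e\<in>elements st. elem_norm_sq b p M x (u s) e) has_real_derivative d)
          (at t within T)
        \<and> (1/2) * d \<le> 0)"
proof -
  let ?E = "elements st"
  let ?F = "flux_left st b p M fnum"
  let ?G = "flux_right st b p M fnum"
  have adm: "admissible b p" using degree_p by (simp add: admissible_def)
  have len: "elem_len x e > 0" if "e \<in> ?E" for e
    using mesh that by (simp add: valid_mesh_def elem_len_def)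
  \<comment> \<open>Off the finite set $A$ also the two neighbours vanish, so that both fluxes of such an element are $f^{num}(0, 0)$.\<close>
  obtain A where A: "finite A" "A \<subseteq> ?E"
    and quiet: "\<And>t e k. t \<in> T \<Longrightarrow> e \<in> ?E - A \<Longrightarrow> k \<le> M \<Longrightarrow>
      u t e k = 0\<^sub>v (p + 1) \<and> u t (left_nb st e) k = 0\<^sub>v (p + 1) \<and> u t (right_nb st e) k = 0\<^sub>v (p + 1)"
  proof (cases st)
    case (Periodic N)
    show ?thesis by (rule that[of ?E]) (auto simp: Periodic)
  next
    case Compact_Support
    then obtain S where S: "finite S" "\<And>t e k. t \<in> T \<Longrightarrow> e \<notin> S \<Longrightarrow> k \<le> M \<Longrightarrow> u t e k = 0\<^sub>v (p + 1)"
      using u_support by blast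
    let ?A = "S \<union> (\<lambda>e. e + 1) ` S \<union> (\<lambda>e. e - 1) ` S"
    have "e \<notin> S \<and> e - 1 \<notin> S \<and> e + 1 \<notin> S" if "e \<notin> ?A" for e
      using that by (force simp: image_iff)
    thus ?thesis using S by (intro that[of ?A]) (auto simp: Compact_Support)
  qed
  have state_zero:
    "left_state b p M (u t) e = 0\<^sub>v (M + 1)" "right_state b p M (u t) e = 0\<^sub>v (M + 1)"
    "right_state b p M (u t) (left_nb st e) = 0\<^sub>v (M + 1)"
    "left_state b p M (u t) (right_nb st e) = 0\<^sub>v (M + 1)"
    if "t \<in> T" "e \<in> ?E - A" for t e
    using quiet[OF that] zero_boundary_states[of M "u t" e p b]
      zero_boundary_states[of M "u t" "left_nb st e" p b]
      zero_boundary_states[of M "u t" "right_nb st e" p b] by blast+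
  have shared: "?G (u t) (left_nb st e) k = ?F (u t) e k" if "e \<in> ?E" for t e k
    using neighbours_inverse(3)[OF mesh that] by (simp add: flux_left_def flux_right_def)
  have flux_quiet: "?F (u t) e k = fnum (0\<^sub>v (M + 1)) (0\<^sub>v (M + 1)) $ k"
    "?G (u t) e k = fnum (0\<^sub>v (M + 1)) (0\<^sub>v (M + 1)) $ k" if "t \<in> T" "e \<in> ?E - A" for t e k
    using state_zero[OF that] neighbours_inverse(4)[OF mesh, of e] that(2)
    by (simp_all add: flux_left_def flux_right_def interface_flux_def)

  have mass_deriv: "((\<lambda>s. one_coeffs b p \<bullet> (elem_mass b p x e *\<^sub>v u s e k)) has_real_derivative
      (?F (u t) e k - ?G (u t) e k)) (at t within T)"
    if t: "t \<in> T" and e: "e \<in> ?E" and k: "k \<le> M" for t e k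
  proof -
    have "one_coeffs b p \<bullet> (elem_mass b p x e *\<^sub>v scheme_rhs st b p M x fnum (u t) e k)
        = ?F (u t) e k - ?G (u t) e k"
      by (rule scheme_conservation[where M = M, OF adm len[OF e]]) (rule u_carrier[OF t e])
    moreover have "((\<lambda>s. one_coeffs b p \<bullet> (elem_mass b p x e *\<^sub>v u s e k)) has_real_derivative
        one_coeffs b p \<bullet> (elem_mass b p x e *\<^sub>v scheme_rhs st b p M x fnum (u t) e k)) (at t within T)"
    proof (rule has_real_derivative_linear_form[OF elem_mass_carrier t])
      show "((\<lambda>s. u s e k $ l) has_real_derivative scheme_rhs st b p M x fnum (u t) e k $ l) (at t within T)"
        if "l < p + 1" for l
        using scheme[OF t e k, of l] that by simp
    qed (use u_carrier e k scheme_rhs_carrier[OF adm len[OF e]] in blast)+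
    ultimately show ?thesis by simp
  qed

  have mass_const: "\<exists>c. \<forall>t\<in>T. (\<Sum>\<^sub>\<infinity>e\<in>?E. one_coeffs b p \<bullet> (elem_mass b p x e *\<^sub>v u t e k)) = c"
    if k: "k \<le> M" for k
  proof (rule has_field_derivative_zero_constant)
    show "convex T" using time(1) by (simp add: is_interval_convex)
    fix t assume t: "t \<in> T"
    \<comment> \<open>The flux need not vanish at the zero state; subtracting its value there makes the sums over the elements finite.\<close>
    define c where "c = fnum (0\<^sub>v (M + 1)) (0\<^sub>v (M + 1)) $ k"
    define L where "L = (\<lambda>e. ?F (u t) e k - c)"
    define R where "R = (\<lambda>e. ?G (u t) e k - c)"
    have LR0: "L e = 0" "R e = 0" if "e \<in> ?E" "e \<notin> A" for e
      using flux_quiet[OF t] that by (simp_all add: L_def R_def c_def)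
    have "(\<Sum>\<^sub>\<infinity>e\<in>?E. L e - R e) = (\<Sum>\<^sub>\<infinity>e\<in>?E. L e - R (left_nb st e))"
      using LR0 by (intro infsum_telescope_neighbours[OF mesh] summable_on_if_zero_outside[OF A(1)])
    also have "\<dots> = 0"
      by (rule infsum_0) (simp add: L_def R_def shared)
    finally have total: "(\<Sum>\<^sub>\<infinity>e\<in>?E. ?F (u t) e k - ?G (u t) e k) = 0"
      by (simp add: L_def R_def)
    have "((\<lambda>s. \<Sum>\<^sub>\<infinity>e\<in>?E. one_coeffs b p \<bullet> (elem_mass b p x e *\<^sub>v u s e k)) has_real_derivative
        (\<Sum>\<^sub>\<infinity>e\<in>?E. ?F (u t) e k - ?G (u t) e k)) (at t within T)"
    proof (rule has_real_derivative_infsum_zero_outside[OF A t])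
      fix s e assume "s \<in> T" "e \<in> ?E - A"
      moreover have "elem_mass b p x e *\<^sub>v 0\<^sub>v (p + 1) = 0\<^sub>v (p + 1)"
        using elem_mass_carrier[of b p x e] by auto
      moreover have "one_coeffs b p \<in> carrier_vec (p + 1)"
        using one_coeffs_represents_1(1)[OF adm] by simp
      ultimately show "one_coeffs b p \<bullet> (elem_mass b p x e *\<^sub>v u s e k) = 0"
        using quiet[of s e k] k by simp
    next
      fix e assume "e \<in> A"
      thus "((\<lambda>s. one_coeffs b p \<bullet> (elem_mass b p x e *\<^sub>v u s e k)) has_real_derivative
          ?F (u t) e k - ?G (u t) e k) (at t within T)"
        using mass_deriv[OF t _ k] A(2) by blast
    next
      fix e assume "e \<in> ?E - A"
      thus "?F (u t) e k - ?G (u t) e k = 0" using flux_quiet[OF t] by simp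
    qed
    thus "((\<lambda>s. \<Sum>\<^sub>\<infinity>e\<in>?E. one_coeffs b p \<bullet> (elem_mass b p x e *\<^sub>v u s e k)) has_real_derivative 0)
        (at t within T)"
      unfolding total .
  qed

  have entropy: "\<exists>d. ((\<lambda>s. \<Sum>\<^sub>\<infinity>e\<in>?E. elem_norm_sq b p M x (u s) e) has_real_derivative d)
      (at t within T) \<and> (1/2) * d \<le> 0" if t: "t \<in> T" for t
  proof -
    define L where "L = (\<lambda>e. (\<Sum>k\<le>M. left_state b p M (u t) e $ k * ?F (u t) e k)
        - flux_potential M (left_state b p M (u t) e))"
    define R where "R = (\<lambda>e. (\<Sum>k\<le>M. right_state b p M (u t) e $ k * ?G (u t) e k)
        - flux_potential M (right_state b p M (u t) e))"
    have LR0: "L e = 0" "R e = 0" if "e \<in> ?E" "e \<notin> A" for e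
      using state_zero[OF t, of e] that flux_potential_zero[of M] by (simp_all add: L_def R_def)
    have rate: "((\<lambda>s. elem_norm_sq b p M x (u s) e) has_real_derivative 2 * (L e - R e)) (at t within T)"
      if e: "e \<in> ?E" for e
    proof -
      have "transpose_mat (elem_mass b p x e) = elem_mass b p x e"
        using sbp_operators.mass_symmetric[OF element_sbp_operators[OF adm len[OF e]]] .
      then have "((\<lambda>s. \<Sum>k\<le>M. u s e k \<bullet> (elem_mass b p x e *\<^sub>v u s e k)) has_real_derivative
          (\<Sum>k\<le>M. 2 * (u t e k \<bullet> (elem_mass b p x e *\<^sub>v scheme_rhs st b p M x fnum (u t) e k))))
          (at t within T)"
      proof (intro DERIV_sum has_real_derivative_quadratic_form[OF elem_mass_carrier _ t])
        show "((\<lambda>s. u s e k $ l) has_real_derivative scheme_rhs st b p M x fnum (u t) e k $ l) (at t within T)"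
          if "k \<in> {..M}" "l < p + 1" for k l
          using scheme[OF t e, of k l] that by simp
      qed (use u_carrier e scheme_rhs_carrier[OF adm len[OF e]] in auto)
      moreover have "(\<Sum>k\<le>M. u t e k \<bullet> (elem_mass b p x e *\<^sub>v scheme_rhs st b p M x fnum (u t) e k))
          = L e - R e"
        unfolding L_def R_def
        by (rule scheme_entropy_rate[OF adm len[OF e]]) (rule u_carrier[OF t e])
      ultimately show ?thesis
        by (simp add: elem_norm_sq_def flip: sum_distrib_left)
    qed
    have deriv: "((\<lambda>s. \<Sum>\<^sub>\<infinity>e\<in>?E. elem_norm_sq b p M x (u s) e) has_real_derivative
        (\<Sum>\<^sub>\<infinity>e\<in>?E. 2 * (L e - R e))) (at t within T)"
    proof (rule has_real_derivative_infsum_zero_outside[OF A t])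
      fix s e assume "s \<in> T" "e \<in> ?E - A"
      moreover have "elem_mass b p x e *\<^sub>v 0\<^sub>v (p + 1) = 0\<^sub>v (p + 1)"
        using elem_mass_carrier[of b p x e] by auto
      ultimately show "elem_norm_sq b p M x (u s) e = 0"
        using quiet[of s e] by (simp add: elem_norm_sq_def)
    qed (use rate A(2) LR0 in auto)
    have "(\<Sum>\<^sub>\<infinity>e\<in>?E. 2 * (L e - R e)) = 2 * (\<Sum>\<^sub>\<infinity>e\<in>?E. L e - R e)"
      by (rule infsum_cmult_right')
    moreover have "(\<Sum>\<^sub>\<infinity>e\<in>?E. L e - R e) = (\<Sum>\<^sub>\<infinity>e\<in>?E. L e - R (left_nb st e))"
      using LR0 by (intro infsum_telescope_neighbours[OF mesh] summable_on_if_zero_outside[OF A(1)])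
    moreover have "(\<Sum>\<^sub>\<infinity>e\<in>?E. L e - R (left_nb st e)) \<le> 0"
      unfolding L_def R_def
      by (rule infsum_nonpos_real) (rule interface_entropy_production_nonpos[OF mesh _ fnum_stable fnum_carrier])
    ultimately have "(1/2) * (\<Sum>\<^sub>\<infinity>e\<in>?E. 2 * (L e - R e)) \<le> 0" by linarith
    with deriv show ?thesis by (intro exI conjI)
  qed

  show ?thesis
    by (intro conjI ballI allI impI mass_deriv shared mass_const entropy)
qed

end
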